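(* Let $0<T_{\min}\le T_{\max}<\infty$ and let the growth condition (defined in the context) hold for the family $\mathcal S_{\mathrm{rng}}(T_{\min},T_{\max})$. The following are equivalent: (i) the impulsive system is strongly UGES over $\mathcal S_{\mathrm{rng}}(T_{\min},T_{\max})$; (ii) there exist $p\ge1$ and $b>0$ such that for all $\sigma\in\mathcal S_{\mathrm{rng}}(T_{\min},T_{\max})$, all $s\ge0$ and all $x\in X$ $$\int_s^\infty\|U_\sigma(t,s)x\|^p\,dt+\sum_{k:\ t_k>s}\|U_\sigma(t_k^-,s)x\|^p\le b^p\|x\|^p;$$ (iii) there exist $p\ge1$, $c>0$ and a functional $\bar V:[0,T_{\max}]\times X\to\mathbb R_{\ge0}$, Lipschitz on bounded subsets of $X$ uniformly in $\tau$ and continuous in $\tau$, such that for all $x\in X$ $$\bar V(\tau,x)\le c\|x\|^p\ \ \forall\tau\in[0,T_{\max}],\qquad \underline D^+\bar V(\tau,x)\le-\|x\|^p\ \ \forall\tau\in[0,T_{\max}),$$ $$\bar V(0,Jx)-\bar V(\theta,x)\le-\|x\|^p\ \ \forall\theta\in[T_{\min},T_{\max}];$$ (iv) there exist $p\ge1$, $\hat c>0$ and a functional $V_d:X\to\mathbb R_{\ge0}$, Lipschitz on bounded subsets of $X$, such that $$V_d(x)\le\hat c\|x\|^p,\qquad V_d(S(\theta)Jx)-V_d(x)\le-\|x\|^p,\qquad\forall x\in X,\ \theta\in[T_{\min},T_{\max}].$$ Moreover, when (i) holds, an explicit functional witnessing (iii) is $$\bar V(\tau,x):=\sup_{\sigma\in\mathcal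 S^{(\tau)}_{\mathrm{rng}}}\left[\int_0^\infty\|U_\sigma(s,0)x\|^p\,ds+\sum_{k\ge1}\|U_\sigma(t_k^-,0)x\|^p\right],$$ where, for $\tau\in[0,T_{\max}]$, $\mathcal S^{(\tau)}_{\mathrm{rng}}$ is the set of impulse sequences $\sigma$ with $t_1^\sigma\in[\max(T_{\min}-\tau,0),\,T_{\max}-\tau]$ and $t_{k+1}^\sigma-t_k^\sigma\in[T_{\min},T_{\max}]$ for all $k\ge1$ (a degenerate immediate first jump $t_1^\sigma=0^+$ being allowed when $\tau\ge T_{\min}$; see context).
   Context: Setting. $X$ is a Banach space with norm $\|\cdot\|$; $A:D(A)\subset X\to X$ generates a strongly continuous ($C_0$) semigroup $(S(t))_{t\ge0}$ on $X$; $J\in L(X)$ is bounded, $J\neq0$, $JD(A)\subset D(A)$. $\mathcal S_{0,\infty}$ is the set of sequences $\sigma=\{t_k\}_{k\ge1}$ (also written $t_k^\sigma$) with, setting $t_0:=0$, $t_{k+1}>t_k$ for all $k\ge0$ and $t_k\to\infty$; $\mathbb T_\sigma:=\{t_k:k\ge1\}$. $\mathcal S_{\mathrm{rng}}(T_{\min},T_{\max}):=\{\sigma\in\mathcal S_{0,\infty}:T_{\min}\le t_{k+1}-t_k\le T_{\max}\ \forall k\ge0\}$. The impulsive system is $\dot x(t)=Ax(t)$ for $t\notin\mathbb T_\sigma$, $x(t)=Jx(t^-)$ for $t\in\mathbb T_\sigma$. Its propagator $U_\sigma(t,s)$, $t\ge s\ge0$, is: $U_\sigma(t,s)=S(t-s)$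 if $(s,t]\cap\mathbb T_\sigma=\varnothing$; otherwise, if $t_l<\dots<t_m$ are the impulse times in $(s,t]$, $U_\sigma(t,s)=S(t-t_m)JS(t_m-t_{m-1})J\cdots JS(t_l-s)$. For $s<t_k$, $U_\sigma(t_k^-,s)x:=\lim_{t\uparrow t_k}U_\sigma(t,s)x$. $\kappa_\sigma(t,s):=\#(\mathbb T_\sigma\cap(s,t])$. Immediate first jump: for a sequence with $t_1=0^+$ followed by impulse times $t_2<t_3<\dots$ (here $t_2\in[T_{\min},T_{\max}]$), $U_\sigma(t_1^-,0)x=x$ and, writing $\sigma'=\{t_{k+1}\}_{k\ge1}$, $U_\sigma(s,0)x=U_{\sigma'}(s,0)Jx$ for $s>0$; so the bracket in the supremum equals $\|x\|^p+\int_0^\infty\|U_{\sigma'}(s,0)Jx\|^pds+\sum_{k\ge1}\|U_{\sigma'}(t_{k}^{\sigma'-},0)Jx\|^p$. Strong UGES over a family $\mathcal S$: there exist $M\ge1$, $\alpha>0$, $\rho\in(0,1)$ such that $\|U_\sigma(t,s)\|\le M\rho^{\kappa_\sigma(t,s)}e^{-\alpha(t-s)}$ for all $t\ge s\ge0$ and all $\sigma\in\mathcal S$. Growth condition for $\mathcal S_{\mathrm{rng}}(T_{\min},T_{\max})$: there exist a piecewise continuous $g:\mathbb R_{\ge0}\to\mathbb R_{>0}$ bounded below by some $c_0>0$, and $\mu>1$, such that $\|U_\sigma(t,s)x\|\le g(t-s)\mu^{\kappa_\sigma(t,s)}\|x\|$ for all $t\ge s\ge0$, $x\in X$, $\sigma\in\mathcal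 S_{\mathrm{rng}}(T_{\min},T_{\max})$, and $\sup_{0\le\tau<T_{\max}}g(\tau)<\infty$. Functionals. $\bar V$ is Lipschitz on bounded subsets of $X$ uniformly in $\tau$ if for every $r>0$ there is $L_r>0$ with $|\bar V(\tau,x)-\bar V(\tau,y)|\le L_r\|x-y\|$ for all $\|x\|,\|y\|<r$ and all $\tau$ (similarly for $V_d$, without $\tau$). $\underline D^+\bar V(\tau,x):=\liminf_{h\downarrow0}h^{-1}\big(\bar V(\tau+h,S(h)x)-\bar V(\tau,x)\big)$. *)

theory Defs
  imports "HOL-Analysis.Analysis"
begin

text \<open>
  Banach spaces are real (class \<^class>\<open>banach\<close>); a complex space is covered by restriction of
  scalars. The values of a semigroup at negative times are irrelevant throughout.
\<close>

definition C0_semigroup :: "(real \<Rightarrow> ('a::banach \<Rightarrow>\<^sub>L 'a)) \<Rightarrow> bool" where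
  "C0_semigroup S \<longleftrightarrow>
     S 0 = id_blinfun \<and>
     (\<forall>t\<ge>0. \<forall>s\<ge>0. S (t + s) = S t o\<^sub>L S s) \<and>
     (\<forall>x. ((\<lambda>t. S t x) \<longlongrightarrow> x) (at_right 0))"

definition generates :: "('a::banach \<Rightarrow> 'a) \<Rightarrow> 'a set \<Rightarrow> (real \<Rightarrow> ('a \<Rightarrow>\<^sub>L 'a)) \<Rightarrow> bool" where
  "generates A D S \<longleftrightarrow>
     C0_semigroup S \<and>
     D = {x. \<exists>y. ((\<lambda>h. (S h x - x) /\<^sub>R h) \<longlongrightarrow> y) (at_right 0)} \<and>
     (\<forall>x\<in>D. ((\<lambda>h. (S h x - x) /\<^sub>R h) \<longlongrightarrow> A x) (at_right 0))"

text \<open>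
  A sequence $(t_k)_{k \ge 1}$ is stored together with $t_0 = 0$; the value at index 0 is not an
  impulse time.
\<close>

definition impulse_seqs :: "(nat \<Rightarrow> real) set" where
  "impulse_seqs = {\<sigma>. \<sigma> 0 = 0 \<and> (\<forall>k. \<sigma> k < \<sigma> (Suc k)) \<and> filterlim \<sigma> at_top sequentially}"

definition impulse_times :: "(nat \<Rightarrow> real) \<Rightarrow> real set" where
  "impulse_times \<sigma> = \<sigma> ` {1..}"

definition range_seqs :: "real \<Rightarrow> real \<Rightarrow> (nat \<Rightarrow> real) set" where
  "range_seqs Tmin Tmax = {\<sigma> \<in> impulse_seqs. \<forall>k. \<sigma> (Suc k) - \<sigma> k \<in> {Tmin..Tmax}}"

definition impulse_count :: "(nat \<Rightarrow> real) \<Rightarrow> real \<Rightarrow> real \<Rightarrow> nat" where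
  "impulse_count \<sigma> t s = card (impulse_times \<sigma> \<inter> {s<..t})"

text \<open>Evolution from \<open>s\<close> to \<open>t\<close> with jumps at the listed times, earliest first.\<close>

primrec flow_jumps ::
  "(real \<Rightarrow> ('a::banach \<Rightarrow>\<^sub>L 'a)) \<Rightarrow> ('a \<Rightarrow>\<^sub>L 'a) \<Rightarrow> real list \<Rightarrow> real \<Rightarrow> real \<Rightarrow> ('a \<Rightarrow>\<^sub>L 'a)" where
  "flow_jumps S J [] t s = S (t - s)"
| "flow_jumps S J (u # us) t s = flow_jumps S J us t u o\<^sub>L (J o\<^sub>L S (u - s))"

text \<open>The set of impulse times in $(s,t]$ is finite for \<open>\<sigma> \<in> impulse_seqs\<close>.\<close>

definition propagator ::
  "(real \<Rightarrow> ('a::banach \<Rightarrow>\<^sub>L 'a)) \<Rightarrow> ('a \<Rightarrow>\<^sub>L 'a) \<Rightarrow> (nat \<Rightarrow> real) \<Rightarrow> real \<Rightarrow> real \<Rightarrow> ('a \<Rightarrow>\<^sub>L 'a)" where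
  "propagator S J \<sigma> t s =
     flow_jumps S J (sorted_list_of_set (impulse_times \<sigma> \<inter> {s<..t})) t s"

definition propagator_left ::
  "(real \<Rightarrow> ('a::banach \<Rightarrow>\<^sub>L 'a)) \<Rightarrow> ('a \<Rightarrow>\<^sub>L 'a) \<Rightarrow> (nat \<Rightarrow> real) \<Rightarrow> real \<Rightarrow> real \<Rightarrow> 'a \<Rightarrow> 'a" where
  "propagator_left S J \<sigma> t s x = Lim (at_left t) (\<lambda>r. propagator S J \<sigma> r s x)"

definition strongly_UGES ::
  "(real \<Rightarrow> ('a::banach \<Rightarrow>\<^sub>L 'a)) \<Rightarrow> ('a \<Rightarrow>\<^sub>L 'a) \<Rightarrow> (nat \<Rightarrow> real) set \<Rightarrow> bool" where
  "strongly_UGES S J \<S> \<longleftrightarrow>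
     (\<exists>M \<alpha> \<rho>. 1 \<le> M \<and> 0 < \<alpha> \<and> 0 < \<rho> \<and> \<rho> < 1 \<and>
        (\<forall>\<sigma>\<in>\<S>. \<forall>s\<ge>0. \<forall>t\<ge>s.
           norm (propagator S J \<sigma> t s) \<le> M * \<rho> ^ impulse_count \<sigma> t s * exp (- \<alpha> * (t - s))))"

definition piecewise_continuous :: "(real \<Rightarrow> real) \<Rightarrow> bool" where
  "piecewise_continuous g \<longleftrightarrow>
     (\<forall>T. finite {t \<in> {0<..<T}. \<not> isCont g t}) \<and>
     (\<forall>t\<ge>0. \<exists>l. (g \<longlongrightarrow> l) (at_right t)) \<and>
     (\<forall>t>0. \<exists>l. (g \<longlongrightarrow> l) (at_left t))"

definition growth_condition ::
  "(real \<Rightarrow> ('a::banach \<Rightarrow>\<^sub>L 'a)) \<Rightarrow> ('a \<Rightarrow>\<^sub>L 'a) \<Rightarrow> real \<Rightarrow> real \<Rightarrow> bool" where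
  "growth_condition S J Tmin Tmax \<longleftrightarrow>
     (\<exists>g c\<^sub>0 \<mu>. piecewise_continuous g \<and> 0 < c\<^sub>0 \<and> (\<forall>t\<ge>0. c\<^sub>0 \<le> g t) \<and> 1 < \<mu> \<and>
        (\<forall>\<sigma>\<in>range_seqs Tmin Tmax. \<forall>s\<ge>0. \<forall>t\<ge>s. \<forall>x.
           norm (propagator S J \<sigma> t s x) \<le> g (t - s) * \<mu> ^ impulse_count \<sigma> t s * norm x) \<and>
        bdd_above (g ` {0..<Tmax}))"

text \<open>$\int_s^\infty \|U_\sigma(t,s)x\|^p\,dt + \sum_{t_k > s} \|U_\sigma(t_k^-,s)x\|^p$, possibly infinite.\<close>

definition trajectory_cost ::
  "(real \<Rightarrow> ('a::banach \<Rightarrow>\<^sub>L 'a)) \<Rightarrow> ('a \<Rightarrow>\<^sub>L 'a) \<Rightarrow> real \<Rightarrow> (nat \<Rightarrow> real) \<Rightarrow> real \<Rightarrow> 'a \<Rightarrow> ennreal" where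
  "trajectory_cost S J p \<sigma> s x =
     (\<integral>\<^sup>+ t\<in>{s..}. ennreal (norm (propagator S J \<sigma> t s x) powr p) \<partial>lborel) +
     (\<Sum>\<^sub>\<infinity>k\<in>{k. 1 \<le> k \<and> s < \<sigma> k}. ennreal (norm (propagator_left S J \<sigma> (\<sigma> k) s x) powr p))"

definition lipschitz_on_bounded :: "real set \<Rightarrow> (real \<Rightarrow> 'a::real_normed_vector \<Rightarrow> real) \<Rightarrow> bool" where
  "lipschitz_on_bounded I V \<longleftrightarrow>
     (\<forall>r>0. \<exists>L>0. \<forall>\<tau>\<in>I. \<forall>x y. norm x < r \<longrightarrow> norm y < r \<longrightarrow> \<bar>V \<tau> x - V \<tau> y\<bar> \<le> L * norm (x - y))"

definition lower_dini ::
  "(real \<Rightarrow> ('a::banach \<Rightarrow>\<^sub>L 'a)) \<Rightarrow> (real \<Rightarrow> 'a \<Rightarrow> real) \<Rightarrow> real \<Rightarrow> 'a \<Rightarrow> ereal" where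
  "lower_dini S V \<tau> x = Liminf (at_right 0) (\<lambda>h. ereal ((V (\<tau> + h) (S h x) - V \<tau> x) / h))"

definition timer_lyapunov ::
  "(real \<Rightarrow> ('a::banach \<Rightarrow>\<^sub>L 'a)) \<Rightarrow> ('a \<Rightarrow>\<^sub>L 'a) \<Rightarrow> real \<Rightarrow> real \<Rightarrow> real \<Rightarrow> real \<Rightarrow>
   (real \<Rightarrow> 'a \<Rightarrow> real) \<Rightarrow> bool" where
  "timer_lyapunov S J Tmin Tmax p c V \<longleftrightarrow>
     (\<forall>\<tau>\<in>{0..Tmax}. \<forall>x. 0 \<le> V \<tau> x) \<and>
     lipschitz_on_bounded {0..Tmax} V \<and>
     (\<forall>x. continuous_on {0..Tmax} (\<lambda>\<tau>. V \<tau> x)) \<and>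
     (\<forall>\<tau>\<in>{0..Tmax}. \<forall>x. V \<tau> x \<le> c * norm x powr p) \<and>
     (\<forall>\<tau>\<in>{0..<Tmax}. \<forall>x. lower_dini S V \<tau> x \<le> ereal (- (norm x powr p))) \<and>
     (\<forall>\<theta>\<in>{Tmin..Tmax}. \<forall>x. V 0 (J x) - V \<theta> x \<le> - (norm x powr p))"

definition discrete_lyapunov ::
  "(real \<Rightarrow> ('a::banach \<Rightarrow>\<^sub>L 'a)) \<Rightarrow> ('a \<Rightarrow>\<^sub>L 'a) \<Rightarrow> real \<Rightarrow> real \<Rightarrow> real \<Rightarrow> real \<Rightarrow>
   ('a \<Rightarrow> real) \<Rightarrow> bool" where
  "discrete_lyapunov S J Tmin Tmax p c V \<longleftrightarrow>
     (\<forall>x. 0 \<le> V x) \<and>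
     (\<forall>r>0. \<exists>L>0. \<forall>x y. norm x < r \<longrightarrow> norm y < r \<longrightarrow> \<bar>V x - V y\<bar> \<le> L * norm (x - y)) \<and>
     (\<forall>x. V x \<le> c * norm x powr p) \<and>
     (\<forall>\<theta>\<in>{Tmin..Tmax}. \<forall>x. V (S \<theta> (J x)) - V x \<le> - (norm x powr p))"

text \<open>
  Impulse sequences compatible with a timer that has already run for time \<open>\<tau>\<close>. The value
  \<open>\<sigma> 1 = 0\<close> (possible exactly when \<open>Tmin \<le> \<tau>\<close>) encodes the immediate first jump $t_1 = 0^+$;
  the remaining impulse times then form the sequence \<open>\<lambda>k. \<sigma> (Suc k)\<close>, which starts at
  \<open>\<sigma> 1 = 0\<close> as required of a member of \<open>impulse_seqs\<close>.
\<close>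

definition timer_seqs :: "real \<Rightarrow> real \<Rightarrow> real \<Rightarrow> (nat \<Rightarrow> real) set" where
  "timer_seqs Tmin Tmax \<tau> =
     {\<sigma>. \<sigma> 0 = 0 \<and> \<sigma> 1 \<in> {max (Tmin - \<tau>) 0..Tmax - \<tau>} \<and>
         (\<forall>k\<ge>1. \<sigma> (Suc k) - \<sigma> k \<in> {Tmin..Tmax})}"

text \<open>
  The cost from time 0. After an immediate jump, $U_\sigma(t_1^-,0)x = x$ contributes
  $\|x\|^p$ and the state restarts at \<open>J x\<close>.
\<close>

definition timer_cost ::
  "(real \<Rightarrow> ('a::banach \<Rightarrow>\<^sub>L 'a)) \<Rightarrow> ('a \<Rightarrow>\<^sub>L 'a) \<Rightarrow> real \<Rightarrow> (nat \<Rightarrow> real) \<Rightarrow> 'a \<Rightarrow> ennreal" where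
  "timer_cost S J p \<sigma> x =
     (if \<sigma> 1 = 0
      then ennreal (norm x powr p) + trajectory_cost S J p (\<lambda>k. \<sigma> (Suc k)) 0 (J x)
      else trajectory_cost S J p \<sigma> 0 x)"

definition sup_functional ::
  "(real \<Rightarrow> ('a::banach \<Rightarrow>\<^sub>L 'a)) \<Rightarrow> ('a \<Rightarrow>\<^sub>L 'a) \<Rightarrow> real \<Rightarrow> real \<Rightarrow> real \<Rightarrow> real \<Rightarrow> 'a \<Rightarrow> ennreal" where
  "sup_functional S J Tmin Tmax p \<tau> x = (SUP \<sigma>\<in>timer_seqs Tmin Tmax \<tau>. timer_cost S J p \<sigma> x)"

end

theory Submission
  imports Defs
begin

text \<open>
  Between two impulses the state moves freely for at most \<open>Tmax\<close>, so everything is decided by the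
  products of the maps \<open>J S(d 0)\<close>, \<open>J S(d 1)\<close>, \<open>\<dots>\<close>, where the waiting times \<open>d k\<close> vary
  freely in \<open>[Tmin, Tmax]\<close>. On this compact range the semigroup is bounded by the growth condition
  (\<open>growth_condition_imp_semigroup_bound\<close>). The pivot of the proof is the property \<open>decaying\<close>: the
  norm of the \<open>k\<close>-fold product is at most \<open>K r ^ k\<close> with \<open>r < 1\<close>, uniformly in the waiting
  times. It is equivalent to strong UGES, since \<open>k\<close> jumps take a time of at most
  \<open>(k + 1) Tmax\<close> and half of the geometric rate can be traded for decay in time.

  From each of the conditions (ii), (iii) and (iv) one extracts the same weaker information: the
  \<open>p\<close>-th powers of the norms of the states just before the jumps have a sum bounded by a multiple
  of \<open>\<parallel>x\<parallel>\<^sup>p\<close>. For (ii) this is part of the hypothesis; for (iii) and (iv) the sum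
  telescopes along the Lyapunov functional. As the waiting times after any jump are again arbitrary,
  this bound restarts at every jump, and Datko's argument turns it into geometric decay
  (\<open>summable_left_states_imp_decaying\<close>).

  Conversely, assume geometric decay. The cost of a trajectory is a series of stage costs
  (\<open>trajectory_cost_on_grid\<close>), dominated by a geometric series; hence it is bounded by a
  multiple of \<open>\<parallel>x\<parallel>\<^sup>p\<close> and Lipschitz in \<open>x\<close> on bounded sets, uniformly in the
  waiting times, and both properties pass to the supremum \<open>V\<close> over all waiting times. The
  functional \<open>V\<close> satisfies the Dini condition because trajectories started later embed into those
  started earlier (\<open>timer_sup_flow\<close>), and the jump condition because an immediate jump is one of
  the competitors (\<open>timer_sup_ge_first_stage\<close>). The functional
  \<open>\<parallel>x\<parallel>\<^sup>p + V 0 (J x)\<close> serves in (iv).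
\<close>

section \<open>Real analysis\<close>

lemma powr_lipschitz:
  fixes a b R p :: real
  assumes "0 \<le> a" "a \<le> R" "0 \<le> b" "b \<le> R" "1 \<le> p"
  shows "\<bar>a powr p - b powr p\<bar> \<le> p * R powr (p - 1) * \<bar>a - b\<bar>"
proof -
  have main: "y powr p - x powr p \<le> p * R powr (p - 1) * (y - x)"
    if xy: "0 \<le> x" "x < y" "y \<le> R" for x y
  proof -
    have "continuous_on {x..y} (\<lambda>t. t powr p)"
      using xy assms by (intro continuous_on_powr') auto
    moreover have "((\<lambda>t. t powr p) has_derivative (\<lambda>h. (p * t powr (p - 1)) * h)) (at t)"
      if "x < t" "t < y" for t
      using that xy has_real_derivative_powr[of t p]
      by (simp add: has_field_derivative_def mult_commute_abs)
    ultimately obtain z where z: "x < z" "z < y"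
        "y powr p - x powr p = (p * z powr (p - 1)) * (y - x)"
      using mvt[OF xy(2), of "\<lambda>t. t powr p" "\<lambda>t h. (p * t powr (p - 1)) * h"] by auto
    have "z powr (p - 1) \<le> R powr (p - 1)"
      using z xy assms by (intro powr_mono2) auto
    then show ?thesis
      unfolding z(3) using xy assms by (intro mult_right_mono mult_left_mono) auto
  qed
  show ?thesis
  proof (cases a b rule: linorder_cases)
    case less
    have "a powr p \<le> b powr p"
      using less assms by (intro powr_mono2) auto
    then show ?thesis using main[of a b] less assms by (auto simp: abs_if)
  next
    case greater
    have "b powr p \<le> a powr p"
      using greater assms by (intro powr_mono2) auto
    then show ?thesis using main[of b a] greater assms by (auto simp: abs_if)
  qed simp
qed

text \<open>
  Were \<open>\<phi> d > \<phi> 0 + \<epsilon> d\<close>, the last time at which \<open>\<phi>\<close> lies on or below the line of slope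
  \<open>\<epsilon>\<close> through its initial value would be smaller than \<open>d\<close>; there the Dini derivative yields
  a later time with the same property.
\<close>

lemma lower_dini_nonpos_imp_decreasing:
  fixes \<phi> :: "real \<Rightarrow> real"
  assumes d: "0 \<le> d" and cont: "continuous_on {0..d} \<phi>"
    and dini: "\<And>t. 0 \<le> t \<Longrightarrow> t < d \<Longrightarrow>
      Liminf (at_right 0) (\<lambda>h. ereal ((\<phi> (t + h) - \<phi> t) / h)) \<le> 0"
  shows "\<phi> d \<le> \<phi> 0"
proof -
  have slope: "\<phi> d \<le> \<phi> 0 + \<epsilon> * d" if "\<epsilon> > 0" for \<epsilon>
  proof -
    define B where "B = {t \<in> {0..d}. \<phi> t \<le> \<phi> 0 + \<epsilon> * t}"
    have "closed B"
      unfolding B_def by (intro continuous_on_closed_Collect_le cont continuous_intros closed_atLeastAtMost)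
    moreover have "B \<subseteq> {0..d}" by (auto simp: B_def)
    ultimately have "compact B"
      using compact_Icc compact_Int_closed[of "{0..d}" B] by (simp add: Int_absorb1)
    moreover have "B \<noteq> {}" using d by (auto simp: B_def)
    ultimately obtain T where T: "T \<in> B" and T_max: "\<And>t. t \<in> B \<Longrightarrow> t \<le> T"
      using compact_attains_sup[of B] by auto
    have T_le: "0 \<le> T" "T \<le> d" "\<phi> T \<le> \<phi> 0 + \<epsilon> * T" using T by (auto simp: B_def)
    have "T = d"
    proof (rule ccontr)
      assume "T \<noteq> d"
      then have "T < d" using T_le by simp
      have "\<not> (\<forall>\<^sub>F h in at_right 0. ereal \<epsilon> \<le> ereal ((\<phi> (T + h) - \<phi> T) / h))"
      proof
        assume "\<forall>\<^sub>F h in at_right 0. ereal \<epsilon> \<le> ereal ((\<phi> (T + h) - \<phi> T) / h)"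
        then have "ereal \<epsilon> \<le> Liminf (at_right 0) (\<lambda>h. ereal ((\<phi> (T + h) - \<phi> T) / h))"
          by (rule Liminf_bounded)
        also have "\<dots> \<le> 0" using dini T_le \<open>T < d\<close> by simp
        finally show False using \<open>\<epsilon> > 0\<close> by simp
      qed
      then have freq: "\<exists>\<^sub>F h in at_right 0. (\<phi> (T + h) - \<phi> T) / h < \<epsilon>"
        by (simp add: frequently_def not_less)
      have small: "\<forall>\<^sub>F h in at_right 0. 0 < h \<and> h < d - T"
        using \<open>T < d\<close> by (simp add: eventually_at_right_field) (meson diff_gt_0_iff_gt)
      obtain h where h: "(\<phi> (T + h) - \<phi> T) / h < \<epsilon>" "0 < h" "h < d - T"
        using frequently_ex[OF frequently_eventually_conj[OF freq small]] by auto
      then have "\<phi> (T + h) < \<phi> T + \<epsilon> * h" by (simp add: field_simps)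
      then have "T + h \<in> B" using T_le h by (auto simp: B_def algebra_simps)
      then show False using T_max h by fastforce
    qed
    then show ?thesis using T_le by simp
  qed
  show ?thesis
  proof (rule field_le_epsilon)
    fix e :: real assume "e > 0"
    then have "e / (d + 1) * d \<le> e" using d by (simp add: field_simps)
    then show "\<phi> d \<le> \<phi> 0 + e" using slope[of "e / (d + 1)"] \<open>e > 0\<close> d by simp
  qed
qed

text \<open>
  The tail sums \<open>T i = a i + a (i + 1) + \<dots>\<close> satisfy \<open>T (i + 1) \<le> B (T i - T (i + 1))\<close>,
  hence contract by \<open>B / (1 + B)\<close> at each step. This is the discrete-time Datko argument.
\<close>

lemma tail_sums_bounded_imp_geometric_decay:
  fixes a :: "nat \<Rightarrow> real"
  assumes nonneg: "\<And>k. 0 \<le> a k" and "0 \<le> B"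
    and total: "\<And>n. (\<Sum>k<n. a k) \<le> b"
    and tail: "\<And>i n. (\<Sum>k<n. a (Suc i + k)) \<le> B * a i"
  shows "a k \<le> b * (B / (1 + B)) ^ k"
proof -
  have summ: "summable a"
    using nonneg total by (rule summableI_nonneg_bounded)
  define T where "T i = (\<Sum>k. a (i + k))" for i
  have summ_tail: "summable (\<lambda>k. a (i + k))" for i
    using summable_ignore_initial_segment[OF summ, of i] by (simp add: add.commute)
  have T_split: "T i = a i + T (Suc i)" for i
    using suminf_split_head[OF summ_tail[of i]] by (simp add: T_def)
  have T_step: "T (Suc i) \<le> B / (1 + B) * T i" for i
  proof -
    have "T (Suc i) \<le> B * a i"
      unfolding T_def using summ_tail[of "Suc i"] tail by (rule suminf_le_const)
    then show ?thesis using T_split[of i] \<open>0 \<le> B\<close> by (simp add: field_simps)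
  qed
  have "T i \<le> b * (B / (1 + B)) ^ i" for i
  proof (induction i)
    case 0
    show ?case using suminf_le_const[OF summ total] by (simp add: T_def)
  next
    case (Suc i)
    have "T (Suc i) \<le> B / (1 + B) * T i" by (rule T_step)
    also have "\<dots> \<le> B / (1 + B) * (b * (B / (1 + B)) ^ i)"
      using \<open>0 \<le> B\<close> by (intro mult_left_mono Suc) auto
    finally show ?case by (simp add: mult_ac)
  qed
  moreover have "a k \<le> T k"
    using T_split[of k] suminf_nonneg[OF summ_tail[of "Suc k"]] nonneg by (simp add: T_def)
  ultimately show ?thesis by (rule order.trans[rotated])
qed

section \<open>Trajectories as products of jump maps\<close>

definition gaps :: "(nat \<Rightarrow> real) \<Rightarrow> nat \<Rightarrow> real" where
  "gaps u k = u (Suc k) - u k"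

text \<open>
  The start \<open>u 0 = s\<close> is not counted as an impulse, even when it is an impulse time of \<open>\<sigma>\<close>:
  the propagator from \<open>s\<close> starts after that jump.
\<close>

definition jump_grid :: "(nat \<Rightarrow> real) \<Rightarrow> real \<Rightarrow> (nat \<Rightarrow> real) \<Rightarrow> bool" where
  "jump_grid \<sigma> s u \<longleftrightarrow>
     u 0 = s \<and> strict_mono u \<and> filterlim u at_top sequentially \<and>
     impulse_times \<sigma> \<inter> {s<..} = u ` {1..}"

lemma jump_grid_cell:
  assumes "jump_grid \<sigma> s u" "s \<le> t"
  obtains k where "u k \<le> t" "t < u (Suc k)"
proof -
  have "\<forall>\<^sub>F n in sequentially. t < u n"
    using assms unfolding jump_grid_def filterlim_at_top_dense by blast
  then obtain n where "t < u n"
    unfolding eventually_sequentially by blast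
  moreover have "\<not> t < u 0" using assms by (simp add: jump_grid_def)
  ultimately obtain k where "\<forall>i\<le>k. \<not> t < u i" "t < u (Suc k)"
    using ex_least_nat_less[of "\<lambda>n. t < u n" n] by blast
  then show ?thesis using that[of k] by auto
qed

lemma jump_grid_window:
  assumes grid: "jump_grid \<sigma> s u" and cell: "u k \<le> t" "t < u (Suc k)"
  shows "impulse_times \<sigma> \<inter> {s<..t} = u ` {1..k}"
proof -
  have mono: "strict_mono u" using grid by (simp add: jump_grid_def)
  have le_iff: "u j \<le> t \<longleftrightarrow> j \<le> k" for j
  proof
    assume "u j \<le> t"
    then have "u j < u (Suc k)" using cell by simp
    then show "j \<le> k" using mono by (simp add: strict_mono_less)
  next
    assume "j \<le> k"
    then have "u j \<le> u k" using mono by (simp add: strict_mono_less_eq)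
    then show "u j \<le> t" using cell by simp
  qed
  have "impulse_times \<sigma> \<inter> {s<..t} = (impulse_times \<sigma> \<inter> {s<..}) \<inter> {..t}" by auto
  also have "\<dots> = u ` {1..} \<inter> {..t}" using grid by (simp add: jump_grid_def)
  also have "\<dots> = u ` {j \<in> {1..}. u j \<le> t}" by blast
  also have "{j \<in> {1..}. u j \<le> t} = {1..k}" unfolding le_iff by auto
  finally show ?thesis .
qed

lemma jump_grid_count:
  assumes grid: "jump_grid \<sigma> s u" and cell: "u k \<le> t" "t < u (Suc k)"
  shows "impulse_count \<sigma> t s = k"
proof -
  have "inj_on u {1..k}"
    using grid strict_mono_imp_inj_on[of u] inj_on_subset[of u UNIV] by (simp add: jump_grid_def)
  then show ?thesis
    unfolding impulse_count_def jump_grid_window[OF assms] by (simp add: card_image)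
qed

lemma jump_grid_self:
  assumes "\<sigma> \<in> impulse_seqs"
  shows "jump_grid \<sigma> 0 \<sigma>"
proof -
  have mono: "strict_mono \<sigma>" using assms by (simp add: impulse_seqs_def strict_mono_Suc_iff)
  have "impulse_times \<sigma> \<subseteq> {0<..}"
    using assms strict_monoD[OF mono, of 0] by (auto simp: impulse_times_def impulse_seqs_def)
  then show ?thesis
    using assms mono by (auto simp: jump_grid_def impulse_times_def impulse_seqs_def)
qed

lemma jump_grid_exists:
  assumes \<sigma>: "\<sigma> \<in> range_seqs Tmin Tmax" and "0 \<le> s" "0 < Tmin"
  obtains u where "jump_grid \<sigma> s u" "gaps u 0 \<in> {0..Tmax}"
    "\<And>k. gaps u (Suc k) \<in> {Tmin..Tmax}"
proof -
  have seq: "\<sigma> \<in> impulse_seqs" and gap: "\<And>k. \<sigma> (Suc k) - \<sigma> k \<in> {Tmin..Tmax}"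
    using \<sigma> by (auto simp: range_seqs_def)
  have grid0: "jump_grid \<sigma> 0 \<sigma>" using jump_grid_self[OF seq] .
  have mono: "strict_mono \<sigma>" using grid0 by (simp add: jump_grid_def)
  obtain m where m: "\<sigma> m \<le> s" "s < \<sigma> (Suc m)"
    using jump_grid_cell[OF grid0 \<open>0 \<le> s\<close>] .
  define u where "u k = (case k of 0 \<Rightarrow> s | Suc j \<Rightarrow> \<sigma> (Suc m + j))" for k
  have u_simps: "u 0 = s" "\<And>k. u (Suc k) = \<sigma> (Suc m + k)" by (auto simp: u_def)
  have u_step: "u k < u (Suc k)" for k
    using m strict_monoD[OF mono] by (cases k) (auto simp: u_simps)
  have "filterlim (\<lambda>k. \<sigma> (k + Suc m)) at_top sequentially"
    using grid0 filterlim_compose[OF _ filterlim_add_const_nat_at_top, of \<sigma> at_top "Suc m"]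
    unfolding jump_grid_def by blast
  then have "filterlim (\<lambda>k. u (Suc k)) at_top sequentially"
    by (simp add: u_simps add.commute)
  then have lim: "filterlim u at_top sequentially"
    by (simp add: filterlim_sequentially_Suc)
  have "impulse_times \<sigma> \<inter> {s<..} = u ` {1..}"
  proof (intro equalityI subsetI)
    fix t assume "t \<in> impulse_times \<sigma> \<inter> {s<..}"
    then obtain j where j: "t = \<sigma> j" "s < \<sigma> j" by (auto simp: impulse_times_def)
    then have "\<sigma> m < \<sigma> j" using m by simp
    then have "m < j" using mono by (simp add: strict_mono_less)
    then have "t = u (Suc (j - Suc m))" using j by (simp add: u_simps)
    then show "t \<in> u ` {1..}" by auto
  next
    fix t assume "t \<in> u ` {1..}"
    then obtain k where "t = u (Suc k)" by (auto simp: Suc_le_eq gr0_conv_Suc)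
    then have t: "t = \<sigma> (Suc m + k)" by (simp add: u_simps)
    have "\<sigma> (Suc m) \<le> \<sigma> (Suc m + k)" using mono by (simp add: strict_mono_less_eq)
    then have "s < t" using m t by simp
    moreover have "t \<in> impulse_times \<sigma>" unfolding impulse_times_def t by auto
    ultimately show "t \<in> impulse_times \<sigma> \<inter> {s<..}" by auto
  qed
  then have grid: "jump_grid \<sigma> s u"
    using u_step lim by (auto simp: jump_grid_def strict_mono_Suc_iff u_simps)
  have "gaps u 0 \<in> {0..Tmax}" using gap[of m] m by (auto simp: gaps_def u_simps)
  moreover have "gaps u (Suc k) \<in> {Tmin..Tmax}" for k
    using gap[of "Suc m + k"] by (auto simp: gaps_def u_simps)
  ultimately show ?thesis using that grid by blast
qed

text \<open>
  Partial sums of a sequence of admissible gaps form an impulse sequence: the lower bound on the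
  gaps rules out accumulation of impulse times.
\<close>

lemma range_seqs_partial_sums:
  assumes "0 < Tmin" and d: "\<And>k. d k \<in> {Tmin..Tmax}"
  shows "(\<lambda>k. \<Sum>j<k. d j) \<in> range_seqs Tmin Tmax" and "gaps (\<lambda>k. \<Sum>j<k. d j) = d"
proof -
  have "real k * Tmin \<le> (\<Sum>j<k. d j)" for k
    using sum_bounded_below[of "{..<k}" Tmin d] d by auto
  moreover have "filterlim (\<lambda>k. real k * Tmin) at_top sequentially"
    using \<open>0 < Tmin\<close> filterlim_real_sequentially
      filterlim_tendsto_pos_mult_at_top[of "\<lambda>_. Tmin" Tmin sequentially real]
    by (simp add: mult.commute)
  ultimately have "filterlim (\<lambda>k. \<Sum>j<k. d j) at_top sequentially"
    using filterlim_at_top_mono[of "\<lambda>k. real k * Tmin"] by auto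
  moreover have "0 < d k" for k using d[of k] \<open>0 < Tmin\<close> by auto
  ultimately show "(\<lambda>k. \<Sum>j<k. d j) \<in> range_seqs Tmin Tmax"
    using d by (auto simp: range_seqs_def impulse_seqs_def)
  show "gaps (\<lambda>k. \<Sum>j<k. d j) = d" by (auto simp: gaps_def)
qed

lemma flow_jumps_snoc:
  "flow_jumps S J (us @ [v]) t s = S (t - v) o\<^sub>L (J o\<^sub>L flow_jumps S J us v s)"
proof (induction us arbitrary: s)
  case Nil
  show ?case by (rule blinfun_eqI) simp
next
  case (Cons w us)
  show ?case by (rule blinfun_eqI) (simp add: Cons)
qed

text \<open>
  The bound \<open>C\<close> concerns only the compact interval \<open>[0, Tmax]\<close>: no longer stretch of free flow
  occurs between two impulses.
\<close>

locale impulsive_flow =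
  fixes S :: "real \<Rightarrow> ('a::banach \<Rightarrow>\<^sub>L 'a)" and J :: "'a \<Rightarrow>\<^sub>L 'a" and C Tmin Tmax :: real
  assumes semigroup: "C0_semigroup S"
    and Tmin_pos: "0 < Tmin" and Tmin_le: "Tmin \<le> Tmax"
    and C_ge_1: "1 \<le> C" and S_bound: "\<And>t. 0 \<le> t \<Longrightarrow> t \<le> Tmax \<Longrightarrow> norm (S t) \<le> C"
begin

lemma S_0 [simp]: "S 0 x = x"
  using semigroup by (simp add: C0_semigroup_def)

lemma S_add: "0 \<le> t \<Longrightarrow> 0 \<le> s \<Longrightarrow> S (t + s) x = S t (S s x)"
  using semigroup by (simp add: C0_semigroup_def)

lemma norm_S_le: "0 \<le> t \<Longrightarrow> t \<le> Tmax \<Longrightarrow> norm (S t x) \<le> C * norm x"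
  using norm_blinfun[of "S t" x] S_bound[of t] by (meson mult_right_mono norm_ge_zero order_trans)

lemma norm_J_le: "norm (J x) \<le> norm J * norm x"
  by (rule norm_blinfun)

text \<open>
  For \<open>r \<le> t\<close> the difference \<open>S t x - S r x = S r (S (t - r) x - x)\<close> is controlled by
  continuity at zero alone.
\<close>

lemma S_continuous: "continuous_on {0..Tmax} (\<lambda>t. S t x)"
  unfolding continuous_on_iff
proof (intro ballI allI impI)
  fix t \<epsilon> :: real assume t: "t \<in> {0..Tmax}" and "\<epsilon> > 0"
  have "((\<lambda>t. S t x) \<longlongrightarrow> x) (at_right 0)" using semigroup by (simp add: C0_semigroup_def)
  then have "\<forall>\<^sub>F h in at_right 0. dist (S h x) x < \<epsilon> / C"
    using \<open>\<epsilon> > 0\<close> C_ge_1 by (intro tendstoD) auto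
  then obtain \<delta> where \<delta>: "\<delta> > 0" "\<And>h. 0 < h \<Longrightarrow> h < \<delta> \<Longrightarrow> dist (S h x) x < \<epsilon> / C"
    unfolding eventually_at_right_field by auto
  have key: "dist (S r' x) (S r x) < \<epsilon>" if r: "r \<in> {0..Tmax}" "r \<le> r'" "r' - r < \<delta>" for r r'
  proof (cases "r = r'")
    case False
    have "S r' x - S r x = S r (S (r' - r) x - x)"
      using S_add[of r "r' - r" x] r by (simp add: blinfun.diff_right)
    then have "dist (S r' x) (S r x) \<le> C * dist (S (r' - r) x) x"
      using norm_S_le[of r "S (r' - r) x - x"] r by (simp add: dist_norm)
    also have "\<dots> < C * (\<epsilon> / C)"
      using \<delta>(2)[of "r' - r"] r False C_ge_1 by (intro mult_strict_left_mono) auto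
    finally show ?thesis using C_ge_1 by simp
  qed (use \<open>\<epsilon> > 0\<close> in simp)
  show "\<exists>\<delta>>0. \<forall>t'\<in>{0..Tmax}. dist t' t < \<delta> \<longrightarrow> dist (S t' x) (S t x) < \<epsilon>"
  proof (intro exI[of _ \<delta>] conjI ballI impI)
    fix t' assume "t' \<in> {0..Tmax}" "dist t' t < \<delta>"
    then show "dist (S t' x) (S t x) < \<epsilon>"
      using key[of t t'] key[of t' t] t
      by (cases "t \<le> t'") (auto simp: dist_commute dist_real_def)
  qed (use \<delta> in auto)
qed

lemma norm_S_powr_continuous:
  assumes "0 < p"
  shows "continuous_on {0..Tmax} (\<lambda>t. norm (S t x) powr p)"
  using assms by (intro continuous_on_powr' continuous_intros S_continuous) auto

primrec post_jump :: "(nat \<Rightarrow> real) \<Rightarrow> nat \<Rightarrow> ('a \<Rightarrow>\<^sub>L 'a)" where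
  "post_jump d 0 = id_blinfun"
| "post_jump d (Suc k) = (J o\<^sub>L S (d k)) o\<^sub>L post_jump d k"

lemma post_jump_add: "post_jump d (i + k) x = post_jump (\<lambda>j. d (i + j)) k (post_jump d i x)"
  by (induction k) auto

lemma post_jump_front: "post_jump d (Suc k) x = post_jump (\<lambda>j. d (Suc j)) k (J (S (d 0) x))"
  using post_jump_add[of d 1 k x] by simp

text \<open>
  Only the first waiting time is treated separately: the clock may already be running when the
  trajectory starts.
\<close>

definition dwell :: "real \<Rightarrow> real \<Rightarrow> (nat \<Rightarrow> real) set" where
  "dwell a b = {d. d 0 \<in> {a..b} \<and> (\<forall>k. d (Suc k) \<in> {Tmin..Tmax})}"

lemma dwell_subset: "0 \<le> a \<Longrightarrow> b \<le> Tmax \<Longrightarrow> dwell a b \<subseteq> dwell 0 Tmax"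
  by (auto simp: dwell_def)

lemma dwell_shift: "d \<in> dwell a b \<Longrightarrow> (\<lambda>k. d (Suc k)) \<in> dwell Tmin Tmax"
  by (auto simp: dwell_def)

lemma dwell_full_iff: "d \<in> dwell Tmin Tmax \<longleftrightarrow> (\<forall>k. d k \<in> {Tmin..Tmax})"
proof
  assume d: "d \<in> dwell Tmin Tmax"
  show "\<forall>k. d k \<in> {Tmin..Tmax}"
  proof
    fix k show "d k \<in> {Tmin..Tmax}" using d by (cases k) (auto simp: dwell_def)
  qed
qed (auto simp: dwell_def)

lemma dwell_nth:
  assumes "d \<in> dwell 0 Tmax"
  shows "0 \<le> d k" "d k \<le> Tmax"
proof -
  have "0 \<le> d k \<and> d k \<le> Tmax"
    using assms Tmin_pos by (cases k) (auto simp: dwell_def intro: order.trans[of 0 Tmin])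
  then show "0 \<le> d k" "d k \<le> Tmax" by auto
qed

lemma propagator_on_grid:
  assumes grid: "jump_grid \<sigma> s u" and cell: "u k \<le> t" "t < u (Suc k)"
  shows "propagator S J \<sigma> t s = S (t - u k) o\<^sub>L post_jump (gaps u) k"
proof -
  have mono: "strict_mono u" and u0: "u 0 = s" using grid by (auto simp: jump_grid_def)
  have "sorted (map u [1..<Suc k])"
    using mono strict_mono_mono sorted_upt by (blast intro: sorted_map_mono mono_on_subset)
  moreover have "distinct (map u [1..<Suc k])"
    using mono by (simp add: distinct_map strict_mono_imp_inj_on inj_on_subset)
  moreover have "set (map u [1..<Suc k]) = u ` {1..k}"
    unfolding set_map set_upt atLeastLessThanSuc_atLeastAtMost ..
  ultimately have "sorted_list_of_set (u ` {1..k}) = map u [1..<Suc k]"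
    by (metis sorted_list_of_set.idem_if_sorted_distinct)
  moreover have "flow_jumps S J (map u [1..<Suc k]) t s = S (t - u k) o\<^sub>L post_jump (gaps u) k" for t
  proof (induction k arbitrary: t)
    case 0
    show ?case using u0 by (auto intro: blinfun_eqI)
  next
    case (Suc k)
    have "map u [1..<Suc (Suc k)] = map u [1..<Suc k] @ [u (Suc k)]" by simp
    then show ?case
      unfolding \<open>map u [1..<Suc (Suc k)] = _\<close> flow_jumps_snoc Suc
      by (auto simp: gaps_def[of u k] intro!: blinfun_eqI)
  qed
  ultimately show ?thesis
    unfolding propagator_def jump_grid_window[OF assms] by simp
qed

lemma propagator_left_on_grid:
  assumes grid: "jump_grid \<sigma> s u" and gap: "gaps u k \<le> Tmax"
  shows "propagator_left S J \<sigma> (u (Suc k)) s x = S (gaps u k) (post_jump (gaps u) k x)"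
proof -
  define y where "y = post_jump (gaps u) k x"
  have less: "u k < u (Suc k)"
    using grid by (auto simp: jump_grid_def strict_mono_Suc_iff)
  have "continuous_on {0..gaps u k} (\<lambda>t. S t y)"
    using continuous_on_subset[OF S_continuous] gap by auto
  then have "continuous_on {u k..u (Suc k)} (\<lambda>t. S (t - u k) y)"
    by (rule continuous_on_compose2) (auto simp: gaps_def continuous_on_diff)
  then have "((\<lambda>t. S (t - u k) y) \<longlongrightarrow> S (gaps u k) y) (at (u (Suc k)) within {u k..u (Suc k)})"
    using less by (auto simp: continuous_on_def gaps_def)
  then have "((\<lambda>t. S (t - u k) y) \<longlongrightarrow> S (gaps u k) y) (at_left (u (Suc k)))"
    using less by (simp add: at_within_Icc_at_left)
  moreover have "\<forall>\<^sub>F t in at_left (u (Suc k)). S (t - u k) y = propagator S J \<sigma> t s x"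
    using eventually_at_left_real[OF less]
    by eventually_elim (auto simp: propagator_on_grid[OF grid, of k] y_def)
  ultimately have "((\<lambda>t. propagator S J \<sigma> t s x) \<longlongrightarrow> S (gaps u k) y) (at_left (u (Suc k)))"
    by (rule Lim_transform_eventually)
  then show ?thesis
    unfolding propagator_left_def y_def by (intro tendsto_Lim) auto
qed

end

section \<open>The cost of a trajectory as a sum over its waiting times\<close>

context impulsive_flow
begin

text \<open>
  A waiting period is charged for the jump that ends it. An immediate first jump is then nothing
  but a first waiting time \<open>d = 0\<close>, for which the integral vanishes.
\<close>

definition stage :: "real \<Rightarrow> real \<Rightarrow> 'a \<Rightarrow> real" where
  "stage p d y = integral {0..d} (\<lambda>r. norm (S r y) powr p) + norm (S d y) powr p"

definition gap_cost :: "real \<Rightarrow> (nat \<Rightarrow> real) \<Rightarrow> 'a \<Rightarrow> ennreal" where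
  "gap_cost p d x = (\<Sum>k. ennreal (stage p (d k) (post_jump d k x)))"

lemma stage_0 [simp]: "stage p 0 y = norm y powr p"
  by (simp add: stage_def)

lemma norm_S_powr_integrable:
  assumes "0 < p" "0 \<le> a" "b \<le> Tmax"
  shows "(\<lambda>r. norm (S r y) powr p) integrable_on {a..b}"
  using assms
  by (intro integrable_continuous_real continuous_on_subset[OF norm_S_powr_continuous]) auto

lemma stage_integral_nonneg:
  assumes "0 < p" "d \<le> Tmax"
  shows "0 \<le> integral {0..d} (\<lambda>r. norm (S r y) powr p)"
  using assms by (intro integral_nonneg norm_S_powr_integrable) auto

lemma stage_ge_endpoint:
  assumes "0 < p" "d \<le> Tmax"
  shows "norm (S d y) powr p \<le> stage p d y"
  using stage_integral_nonneg[OF assms] by (simp add: stage_def)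

lemma stage_nonneg:
  assumes "0 < p" "d \<le> Tmax"
  shows "0 \<le> stage p d y"
  using stage_ge_endpoint[OF assms, of y] by (rule order.trans[rotated]) simp

lemma gap_cost_front:
  "gap_cost p d x =
     ennreal (stage p (d 0) x) + gap_cost p (\<lambda>k. d (Suc k)) (J (S (d 0) x))"
proof -
  have "gap_cost p d x = ennreal (stage p (d 0) (post_jump d 0 x)) +
      (\<Sum>k. ennreal (stage p (d (Suc k)) (post_jump d (Suc k) x)))"
    unfolding gap_cost_def
    using suminf_offset[of "\<lambda>k. ennreal (stage p (d k) (post_jump d k x))" 1]
    by (simp add: add.commute)
  then show ?thesis
    unfolding gap_cost_def post_jump_front by simp
qed

lemma nn_integral_cell:
  fixes y :: 'a
  assumes "0 < p" "a \<le> b" "b - a \<le> Tmax"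
  defines "f \<equiv> \<lambda>t. norm (S (t - a) y) powr p"
  shows "(\<lambda>t. ennreal (f t) * indicator {a..<b} t) \<in> borel_measurable lborel"
    and "(\<integral>\<^sup>+ t. ennreal (f t) * indicator {a..<b} t \<partial>lborel) =
      ennreal (integral {0..b - a} (\<lambda>r. norm (S r y) powr p))"
proof -
  let ?g = "\<lambda>r. norm (S r y) powr p"
  have "continuous_on {0..b - a} ?g"
    using assms by (intro continuous_on_subset[OF norm_S_powr_continuous]) auto
  then have cont: "continuous_on {a..b} f"
    unfolding f_def by (rule continuous_on_compose2[where f = "\<lambda>t. t - a"]) (auto simp: continuous_on_diff)
  then have "continuous_on {a..<b} f" by (rule continuous_on_subset) auto
  then have "(\<lambda>t. indicator {a..<b} t *\<^sub>R f t) \<in> borel_measurable borel"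
    by (intro borel_measurable_continuous_on_indicator) auto
  moreover have "(\<lambda>t. ennreal (f t) * indicator {a..<b} t) = (\<lambda>t. ennreal (indicator {a..<b} t *\<^sub>R f t))"
    by (auto simp: indicator_def)
  ultimately show "(\<lambda>t. ennreal (f t) * indicator {a..<b} t) \<in> borel_measurable lborel"
    by simp
  have shift: "f \<circ> (+) a = ?g" by (auto simp: f_def)
  have "(?g has_integral integral {0..b - a} ?g) {0..b - a}"
    using assms by (intro integrable_integral norm_S_powr_integrable) auto
  then have "(f has_integral integral {0..b - a} ?g) {a..b}"
    using has_integral_shift_Icc_real[of f a "integral {0..b - a} ?g" 0 "b - a"]
    unfolding shift by simp
  then have "(\<integral>\<^sup>+ t. ennreal (f t) * indicator {a..b} t \<partial>lborel) = ennreal (integral {0..b - a} ?g)"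
    by (intro nn_integral_has_integral_lebesgue') (auto simp: f_def)
  moreover have "(\<integral>\<^sup>+ t. ennreal (f t) * indicator {a..<b} t \<partial>lborel) =
      (\<integral>\<^sup>+ t. ennreal (f t) * indicator {a..b} t \<partial>lborel)"
    using AE_lborel_singleton[of b]
    by (intro nn_integral_cong_AE) (auto elim!: eventually_mono simp: indicator_def)
  ultimately show "(\<integral>\<^sup>+ t. ennreal (f t) * indicator {a..<b} t \<partial>lborel) =
      ennreal (integral {0..b - a} ?g)" by simp
qed

text \<open>
  The half-open cells between consecutive grid points partition the time axis, and on each of them
  the trajectory is a free flow; the last term of a stage is the left limit at the end of its cell.
\<close>

lemma trajectory_cost_on_grid:
  assumes seq: "\<sigma> \<in> impulse_seqs" and grid: "jump_grid \<sigma> s u"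
    and gap: "\<And>k. gaps u k \<le> Tmax" and "0 < p"
  shows "trajectory_cost S J p \<sigma> s x = gap_cost p (gaps u) x"
proof -
  define y where "y k = post_jump (gaps u) k x" for k
  define F where "F t = ennreal (norm (propagator S J \<sigma> t s x) powr p)" for t
  define I where "I k = integral {0..gaps u k} (\<lambda>r. norm (S r (y k)) powr p)" for k
  define W where "W k = norm (S (gaps u k) (y k)) powr p" for k
  define cell where "cell k = {u k..<u (Suc k)}" for k
  have mono: "strict_mono u" and u0: "u 0 = s" using grid by (auto simp: jump_grid_def)
  have step: "u k \<le> u (Suc k)" for k using mono by (simp add: strict_mono_less_eq)
  have "cell j \<inter> cell k = {}" if "j < k" for j k
  proof -
    have "u (Suc j) \<le> u k" using mono that by (simp add: strict_mono_less_eq)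
    then show ?thesis by (auto simp: cell_def)
  qed
  then have "disjoint_family cell"
    unfolding disjoint_family_on_def by (metis Int_commute linorder_neqE_nat)
  moreover have "(\<Union>k. cell k) = {s..}"
  proof (intro equalityI subsetI)
    fix t assume "t \<in> (\<Union>k. cell k)"
    then obtain k where "u k \<le> t" by (auto simp: cell_def)
    moreover have "u 0 \<le> u k" using mono by (simp add: strict_mono_less_eq)
    ultimately show "t \<in> {s..}" using u0 by simp
  next
    fix t assume "t \<in> {s..}"
    then show "t \<in> (\<Union>k. cell k)"
      using jump_grid_cell[OF grid, of t] by (fastforce simp: cell_def)
  qed
  ultimately have split: "indicator {s..} t = (\<Sum>k. indicator (cell k) t :: ennreal)" for t
    using suminf_indicator[of cell t] by simp
  have on_cell: "F t * indicator (cell k) t =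
      ennreal (norm (S (t - u k) (y k)) powr p) * indicator (cell k) t" for t k
    using propagator_on_grid[OF grid, of k t]
    by (auto simp: F_def y_def cell_def indicator_def)
  have meas: "(\<lambda>t. F t * indicator (cell k) t) \<in> borel_measurable lborel" for k
    unfolding on_cell unfolding cell_def
    using nn_integral_cell(1)[OF \<open>0 < p\<close> step] gap by (simp add: gaps_def)
  have "(\<integral>\<^sup>+ t\<in>{s..}. F t \<partial>lborel) = (\<integral>\<^sup>+ t. (\<Sum>k. F t * indicator (cell k) t) \<partial>lborel)"
    unfolding split by simp
  also have "\<dots> = (\<Sum>k. \<integral>\<^sup>+ t. F t * indicator (cell k) t \<partial>lborel)"
    using meas by (rule nn_integral_suminf)
  also have "\<dots> = (\<Sum>k. ennreal (I k))"
    unfolding on_cell unfolding cell_def I_def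
    using nn_integral_cell(2)[OF \<open>0 < p\<close> step] gap by (simp add: gaps_def)
  finally have flow: "(\<integral>\<^sup>+ t\<in>{s..}. F t \<partial>lborel) = (\<Sum>k. ennreal (I k))" .

  define G where "G t = ennreal (norm (propagator_left S J \<sigma> t s x) powr p)" for t
  define K where "K = {k. 1 \<le> k \<and> s < \<sigma> k}"
  have "strict_mono \<sigma>" using jump_grid_self[OF seq] by (simp add: jump_grid_def)
  then have inj: "inj_on \<sigma> K" "inj_on u {1..}"
    using mono strict_mono_imp_inj_on[of u] strict_mono_imp_inj_on[of \<sigma>]
      inj_on_subset[of u UNIV] inj_on_subset[of \<sigma> UNIV] by auto
  have "\<sigma> ` K = impulse_times \<sigma> \<inter> {s<..}" by (auto simp: K_def impulse_times_def)
  also have "\<dots> = u ` {1..}" using grid by (simp add: jump_grid_def)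
  finally have image: "\<sigma> ` K = u ` {1..}" .
  have "(\<Sum>\<^sub>\<infinity>k\<in>K. G (\<sigma> k)) = infsum G (\<sigma> ` K)"
    using infsum_reindex[OF inj(1), of G] by (simp add: o_def)
  also have "\<dots> = (\<Sum>\<^sub>\<infinity>k\<in>{1..}. G (u k))"
    unfolding image using infsum_reindex[OF inj(2), of G] by (simp add: o_def)
  also have "{1..} = range Suc" by (auto simp: image_iff Suc_le_eq gr0_conv_Suc)
  also have "(\<Sum>\<^sub>\<infinity>k\<in>range Suc. G (u k)) = (\<Sum>\<^sub>\<infinity>k. G (u (Suc k)))"
    using infsum_reindex[of Suc UNIV "\<lambda>k. G (u k)"] by (simp add: o_def)
  also have "\<dots> = (\<Sum>k. G (u (Suc k)))"
    by (intro sums_unique has_sum_imp_sums has_sum_infsum nonneg_summable_on_complete) simp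
  also have "\<dots> = (\<Sum>k. ennreal (W k))"
    using propagator_left_on_grid[OF grid gap] by (simp add: G_def W_def y_def)
  finally have jumps: "(\<Sum>\<^sub>\<infinity>k\<in>K. G (\<sigma> k)) = (\<Sum>k. ennreal (W k))" .

  have "trajectory_cost S J p \<sigma> s x = (\<Sum>k. ennreal (I k)) + (\<Sum>k. ennreal (W k))"
    using flow jumps unfolding trajectory_cost_def F_def G_def K_def by simp
  also have "\<dots> = (\<Sum>k. ennreal (I k) + ennreal (W k))"
    by (rule suminf_add) auto
  also have "\<dots> = gap_cost p (gaps u) x"
    using stage_integral_nonneg[OF \<open>0 < p\<close> gap]
    by (simp add: gap_cost_def stage_def I_def W_def y_def ennreal_plus)
  finally show ?thesis .
qed

text \<open>
  The two clauses in the definition of the timer cost merge into one expression, since a vanishing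
  first gap is a legitimate entry of a sequence of waiting times.
\<close>

lemma timer_cost_eq_gap_cost:
  assumes \<sigma>: "\<sigma> \<in> timer_seqs Tmin Tmax \<tau>" and "0 \<le> \<tau>" "0 < p"
  shows "timer_cost S J p \<sigma> x = gap_cost p (gaps \<sigma>) x"
proof -
  let ?\<sigma>' = "\<lambda>k. \<sigma> (Suc k)"
  have \<sigma>0: "\<sigma> 0 = 0" and \<sigma>1: "0 \<le> \<sigma> 1" "\<sigma> 1 \<le> Tmax"
    and gap: "\<And>k. \<sigma> (Suc (Suc k)) - \<sigma> (Suc k) \<in> {Tmin..Tmax}"
    using \<sigma> \<open>0 \<le> \<tau>\<close> by (auto simp: timer_seqs_def)
  have less: "\<sigma> (Suc k) < \<sigma> (Suc (Suc k))" for k using gap[of k] Tmin_pos by auto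
  have gap_le: "gaps \<sigma> k \<le> Tmax" for k
    using \<sigma>0 \<sigma>1 gap by (cases k) (auto simp: gaps_def)
  have "filterlim (\<lambda>k. (\<Sum>j<k. gaps ?\<sigma>' j)) at_top sequentially"
    using range_seqs_partial_sums(1)[of Tmin "gaps ?\<sigma>'" Tmax] gap Tmin_pos
    by (auto simp: range_seqs_def impulse_seqs_def gaps_def)
  moreover have "(\<Sum>j<k. gaps ?\<sigma>' j) = ?\<sigma>' k - \<sigma> 1" for k
    unfolding gaps_def by (subst sum_lessThan_telescope) simp
  ultimately have "filterlim (\<lambda>k. \<sigma> 1 + (?\<sigma>' k - \<sigma> 1)) at_top sequentially"
    by (intro filterlim_tendsto_add_at_top[OF tendsto_const]) simp
  then have lim: "filterlim ?\<sigma>' at_top sequentially" by simp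
  show ?thesis
  proof (cases "\<sigma> 1 = 0")
    case True
    then have seq: "?\<sigma>' \<in> impulse_seqs"
      using less lim by (auto simp: impulse_seqs_def)
    have "timer_cost S J p \<sigma> x = ennreal (norm x powr p) + gap_cost p (gaps ?\<sigma>') (J x)"
      using True trajectory_cost_on_grid[OF seq jump_grid_self[OF seq] _ \<open>0 < p\<close>, of "J x"] gap
      by (simp add: timer_cost_def gaps_def)
    also have "\<dots> = gap_cost p (gaps \<sigma>) x"
      using True \<sigma>0 by (subst (2) gap_cost_front) (simp add: gaps_def[abs_def])
    finally show ?thesis .
  next
    case False
    have "\<sigma> k < \<sigma> (Suc k)" for k
      using False \<sigma>0 \<sigma>1 less by (cases k) auto
    then have seq: "\<sigma> \<in> impulse_seqs"
      using lim \<sigma>0 by (simp add: impulse_seqs_def filterlim_sequentially_Suc)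
    show ?thesis
      using False trajectory_cost_on_grid[OF seq jump_grid_self[OF seq] gap_le \<open>0 < p\<close>]
      by (simp add: timer_cost_def)
  qed
qed

abbreviation timer_dwell :: "real \<Rightarrow> (nat \<Rightarrow> real) set" where
  "timer_dwell \<tau> \<equiv> dwell (max (Tmin - \<tau>) 0) (Tmax - \<tau>)"

lemma gaps_timer_seqs: "gaps ` timer_seqs Tmin Tmax \<tau> = timer_dwell \<tau>"
proof (intro equalityI subsetI)
  fix d assume "d \<in> gaps ` timer_seqs Tmin Tmax \<tau>"
  then show "d \<in> timer_dwell \<tau>" by (auto simp: timer_seqs_def dwell_def gaps_def)
next
  fix d assume d: "d \<in> timer_dwell \<tau>"
  define \<sigma> where "\<sigma> k = (\<Sum>j<k. d j)" for k
  have step: "\<sigma> (Suc k) - \<sigma> k = d k" for k by (simp add: \<sigma>_def)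
  have d_tail: "d k \<in> {Tmin..Tmax}" if "1 \<le> k" for k
    using d that by (cases k) (auto simp: dwell_def)
  have "\<sigma> \<in> timer_seqs Tmin Tmax \<tau>"
    unfolding timer_seqs_def mem_Collect_eq step using d d_tail
    by (auto simp: \<sigma>_def dwell_def)
  moreover have "d = gaps \<sigma>" using step by (auto simp: gaps_def)
  ultimately show "d \<in> gaps ` timer_seqs Tmin Tmax \<tau>" by blast
qed

lemma sup_functional_eq:
  assumes "0 \<le> \<tau>" "0 < p"
  shows "sup_functional S J Tmin Tmax p \<tau> x = (SUP d\<in>timer_dwell \<tau>. gap_cost p d x)"
proof -
  have "sup_functional S J Tmin Tmax p \<tau> x =
      (SUP \<sigma>\<in>timer_seqs Tmin Tmax \<tau>. gap_cost p (gaps \<sigma>) x)"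
    unfolding sup_functional_def using timer_cost_eq_gap_cost assms by (intro SUP_cong) auto
  then show ?thesis by (simp add: gaps_timer_seqs[symmetric] image_image)
qed

end

section \<open>Geometric decay of the jump maps\<close>

context impulsive_flow
begin

definition decaying :: bool where
  "decaying \<longleftrightarrow> (\<exists>K r. 1 \<le> K \<and> 0 < r \<and> r < 1 \<and>
     (\<forall>d\<in>dwell 0 Tmax. \<forall>k. norm (post_jump d k) \<le> K * r ^ k))"

text \<open>
  An estimate for the sequences that start with a full waiting time suffices: a shorter first
  waiting time contributes only the bounded factor \<open>J S(d 0)\<close>.
\<close>

lemma decayingI:
  assumes r: "0 < r" "r < 1" and "0 \<le> L"
    and decay: "\<And>d k. d \<in> dwell Tmin Tmax \<Longrightarrow> norm (post_jump d (Suc k)) \<le> L * r ^ k"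
  shows decaying
proof -
  define L' where "L' = max 1 (L / r)"
  have full: "norm (post_jump d k) \<le> L' * r ^ k" if "d \<in> dwell Tmin Tmax" for d k
  proof (cases k)
    case 0
    then show ?thesis using norm_blinfun_id_le[where 'a = 'a] by (simp add: L'_def)
  next
    case (Suc j)
    have "L \<le> L' * r" using r by (simp add: L'_def max_def field_simps)
    then have "L * r ^ j \<le> L' * r * r ^ j" using r by (intro mult_right_mono) auto
    then show ?thesis using decay[OF that, of j] Suc by (simp add: mult_ac)
  qed
  define K where "K = max 1 (L' * (norm J * C) / r)"
  have "norm (post_jump d k) \<le> K * r ^ k" if d: "d \<in> dwell 0 Tmax" for d k
  proof (cases k)
    case 0
    then show ?thesis using norm_blinfun_id_le[where 'a = 'a] by (simp add: K_def)
  next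
    case (Suc j)
    have "post_jump d k = post_jump (\<lambda>k. d (Suc k)) j o\<^sub>L (J o\<^sub>L S (d 0))"
      unfolding Suc by (rule blinfun_eqI) (simp add: post_jump_front del: post_jump.simps)
    then have "norm (post_jump d k) \<le> norm (post_jump (\<lambda>k. d (Suc k)) j) * norm (J o\<^sub>L S (d 0))"
      using norm_blinfun_compose by simp
    also have "\<dots> \<le> norm (post_jump (\<lambda>k. d (Suc k)) j) * (norm J * norm (S (d 0)))"
      by (intro mult_left_mono norm_blinfun_compose) auto
    also have "\<dots> \<le> (L' * r ^ j) * (norm J * C)"
      using full[OF dwell_shift[OF d]] S_bound[of "d 0"] dwell_nth[OF d, of 0] r
      by (intro mult_mono) (auto simp: L'_def)
    also have "\<dots> = (L' * (norm J * C) / r) * r ^ k" using r Suc by simp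
    also have "\<dots> \<le> K * r ^ k" using r by (intro mult_right_mono) (auto simp: K_def)
    finally show ?thesis .
  qed
  then show ?thesis unfolding decaying_def using r by (intro exI[of _ K] exI[of _ r]) (auto simp: K_def)
qed

lemma full_dwell_grid:
  assumes "d \<in> dwell Tmin Tmax"
  obtains \<sigma> where "\<sigma> \<in> range_seqs Tmin Tmax" "\<sigma> \<in> impulse_seqs" "jump_grid \<sigma> 0 \<sigma>" "gaps \<sigma> = d"
proof -
  have "\<And>k. d k \<in> {Tmin..Tmax}" using assms by (simp add: dwell_full_iff)
  note * = range_seqs_partial_sums[OF Tmin_pos this]
  show ?thesis
    using that[OF *(1) _ _ *(2)] *(1) jump_grid_self by (auto simp: range_seqs_def)
qed

lemma strongly_UGES_imp_decaying:
  assumes "strongly_UGES S J (range_seqs Tmin Tmax)"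
  shows decaying
proof -
  obtain M \<alpha> \<rho> where M: "1 \<le> M" "0 < \<alpha>" "0 < \<rho>" "\<rho> < 1"
    and est: "\<And>\<sigma> s t. \<sigma> \<in> range_seqs Tmin Tmax \<Longrightarrow> 0 \<le> s \<Longrightarrow> s \<le> t \<Longrightarrow>
      norm (propagator S J \<sigma> t s) \<le> M * \<rho> ^ impulse_count \<sigma> t s * exp (- \<alpha> * (t - s))"
    using assms unfolding strongly_UGES_def by blast
  have bound: "norm (post_jump d k) \<le> M * \<rho> ^ k" if d: "d \<in> dwell Tmin Tmax" for d k
  proof -
    obtain \<sigma> where \<sigma>: "\<sigma> \<in> range_seqs Tmin Tmax" "jump_grid \<sigma> 0 \<sigma>" "gaps \<sigma> = d"
      using full_dwell_grid[OF d] .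
    have mono: "strict_mono \<sigma>" and "\<sigma> 0 = 0" using \<sigma>(2) by (auto simp: jump_grid_def)
    then have "0 \<le> \<sigma> k" "\<sigma> k < \<sigma> (Suc k)"
      by (metis strict_mono_less_eq zero_le, simp add: strict_mono_less)
    then have "propagator S J \<sigma> (\<sigma> k) 0 = post_jump d k" "impulse_count \<sigma> (\<sigma> k) 0 = k"
      using propagator_on_grid[OF \<sigma>(2), of k "\<sigma> k"] jump_grid_count[OF \<sigma>(2), of k "\<sigma> k"] \<sigma>(3)
      by (auto intro: blinfun_eqI)
    then have "norm (post_jump d k) \<le> M * \<rho> ^ k * exp (- \<alpha> * \<sigma> k)"
      using est[OF \<sigma>(1), of 0 "\<sigma> k"] \<open>0 \<le> \<sigma> k\<close> by simp
    also have "\<dots> \<le> M * \<rho> ^ k * 1"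
      using M \<open>0 \<le> \<sigma> k\<close> by (intro mult_left_mono) auto
    finally show ?thesis by simp
  qed
  show ?thesis
  proof (rule decayingI)
    show "norm (post_jump d (Suc k)) \<le> M * \<rho> * \<rho> ^ k" if "d \<in> dwell Tmin Tmax" for d k
      using bound[OF that, of "Suc k"] by (simp add: mult_ac)
  qed (use M in auto)
qed

text \<open>
  The decay per jump is split evenly: with \<open>q = sqrt r\<close>, one factor \<open>q ^ k\<close> is kept as decay
  in the number of impulses and the other one becomes decay in time, because \<open>k\<close> jumps leave
  room for a duration of at most \<open>(k + 1) Tmax\<close>.
\<close>

lemma decaying_imp_strongly_UGES:
  assumes decaying
  shows "strongly_UGES S J (range_seqs Tmin Tmax)"
proof -
  obtain K r where K: "1 \<le> K" and r: "0 < r" "r < 1"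
    and decay: "\<And>d k. d \<in> dwell 0 Tmax \<Longrightarrow> norm (post_jump d k) \<le> K * r ^ k"
    using assms unfolding decaying_def by blast
  define q where "q = sqrt r"
  have q: "0 < q" "q < 1" "r = q * q" using r by (auto simp: q_def)
  have Tmax_pos: "0 < Tmax" using Tmin_pos Tmin_le by simp
  define \<alpha> where "\<alpha> = - ln q / Tmax"
  have \<alpha>: "0 < \<alpha>" "exp (- \<alpha> * Tmax) = q"
    using q Tmax_pos by (auto simp: \<alpha>_def divide_neg_pos)
  define M where "M = C * K / q"
  have "1 * 1 \<le> C * K" using C_ge_1 K by (intro mult_mono) auto
  then have M: "1 \<le> M" using q by (simp add: M_def)
  have "norm (propagator S J \<sigma> t s) \<le> M * q ^ impulse_count \<sigma> t s * exp (- \<alpha> * (t - s))"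
    if \<sigma>: "\<sigma> \<in> range_seqs Tmin Tmax" and st: "0 \<le> s" "s \<le> t" for \<sigma> s t
  proof -
    obtain u where grid: "jump_grid \<sigma> s u" and g0: "gaps u 0 \<in> {0..Tmax}"
      and gS: "\<And>k. gaps u (Suc k) \<in> {Tmin..Tmax}"
      using jump_grid_exists[OF \<sigma> st(1) Tmin_pos] by blast
    then have d: "gaps u \<in> dwell 0 Tmax" by (simp add: dwell_def)
    obtain k where k: "u k \<le> t" "t < u (Suc k)" using jump_grid_cell[OF grid st(2)] .
    have "t - s \<le> (\<Sum>j<Suc k. gaps u j)"
      using k grid unfolding gaps_def by (subst sum_lessThan_telescope) (simp add: jump_grid_def)
    also have "\<dots> \<le> real (Suc k) * Tmax"
      using sum_bounded_above[of "{..<Suc k}" "gaps u" Tmax] dwell_nth[OF d] by auto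
    finally have "exp (- \<alpha> * Tmax * real (Suc k)) \<le> exp (- \<alpha> * (t - s))"
      using \<alpha>(1) by (simp add: mult_ac)
    then have time: "q ^ Suc k \<le> exp (- \<alpha> * (t - s))"
      using \<alpha>(2) by (metis exp_of_nat2_mult)
    have "norm (S (t - u k)) \<le> C"
      using k dwell_nth(2)[OF d, of k] by (intro S_bound) (auto simp: gaps_def)
    then have "norm (S (t - u k)) * norm (post_jump (gaps u) k) \<le> C * (K * r ^ k)"
      using decay[OF d, of k] C_ge_1 by (intro mult_mono) auto
    then have "norm (propagator S J \<sigma> t s) \<le> C * (K * r ^ k)"
      unfolding propagator_on_grid[OF grid k] by (rule order.trans[OF norm_blinfun_compose])
    also have "\<dots> = M * q ^ k * q ^ Suc k"
      using q by (simp add: M_def power_mult_distrib)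
    also have "\<dots> \<le> M * q ^ k * exp (- \<alpha> * (t - s))"
      using M q by (intro mult_left_mono time) auto
    finally show ?thesis unfolding jump_grid_count[OF grid k] .
  qed
  then show ?thesis
    unfolding strongly_UGES_def using M \<alpha>(1) q by blast
qed

text \<open>
  Restarting the trajectory after the jump that follows the \<open>i\<close>-th waiting time turns the
  hypothesis into a bound of the remaining sum by a multiple of the \<open>i\<close>-th term.
\<close>

lemma summable_left_states_imp_decaying:
  assumes "1 \<le> p" "0 \<le> b"
    and sums: "\<And>d x n. d \<in> dwell Tmin Tmax \<Longrightarrow>
      (\<Sum>k<n. norm (S (d k) (post_jump d k x)) powr p) \<le> b * norm x powr p"
  shows decaying
proof -
  \<comment> \<open>The summand 1 keeps the rate positive when \<open>b * norm J powr p\<close> vanishes.\<close>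
  define B where "B = b * norm J powr p + 1"
  have B: "0 < B" using assms by (simp add: B_def add_nonneg_pos)
  define q where "q = B / (1 + B)"
  have q: "0 < q" "q < 1" using B by (auto simp: q_def)
  define r where "r = q powr (1 / p)"
  have r: "0 < r" "r < 1"
    using q assms(1) powr_less_mono2[of "1 / p" q 1] by (auto simp: r_def)
  have step: "norm (post_jump d (Suc k)) \<le> (norm J * b powr (1 / p)) * r ^ k"
    if d: "d \<in> dwell Tmin Tmax" for d k
  proof (rule norm_blinfun_bound)
    fix x
    define w where "w k = S (d k) (post_jump d k x)" for k
    have "norm (w k) powr p \<le> (b * norm x powr p) * q ^ k"
      unfolding q_def
    proof (rule tail_sums_bounded_imp_geometric_decay)
      show "(\<Sum>k<n. norm (w k) powr p) \<le> b * norm x powr p" for n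
        unfolding w_def by (rule sums[OF d])
      show "(\<Sum>k<n. norm (w (Suc i + k)) powr p) \<le> B * norm (w i) powr p" for i n
      proof -
        have d': "(\<lambda>j. d (Suc i + j)) \<in> dwell Tmin Tmax" using d by (simp add: dwell_full_iff)
        have "w (Suc i + k) = S (d (Suc i + k)) (post_jump (\<lambda>j. d (Suc i + j)) k (J (w i)))" for k
          unfolding w_def post_jump_add by simp
        then have "(\<Sum>k<n. norm (w (Suc i + k)) powr p) \<le> b * norm (J (w i)) powr p"
          using sums[OF d', of "J (w i)" n] by simp
        also have "\<dots> \<le> b * (norm J * norm (w i)) powr p"
          using assms norm_J_le by (intro mult_left_mono powr_mono2) auto
        also have "\<dots> \<le> B * norm (w i) powr p"
          by (simp add: B_def powr_mult algebra_simps)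
        finally show ?thesis .
      qed
    qed (use B in auto)
    then have "(norm (w k) powr p) powr (1 / p) \<le> (b * norm x powr p * q ^ k) powr (1 / p)"
      using assms(1) by (intro powr_mono2) auto
    also have "\<dots> = b powr (1 / p) * norm x * r ^ k"
      using assms q by (simp add: powr_mult powr_powr r_def powr_power powr_realpow[symmetric] mult_ac)
    finally have "norm (w k) \<le> b powr (1 / p) * norm x * r ^ k"
      using assms(1) by (simp add: powr_powr)
    then have "norm J * norm (w k) \<le> norm J * (b powr (1 / p) * norm x * r ^ k)"
      by (rule mult_left_mono) simp
    then show "norm (post_jump d (Suc k) x) \<le> norm J * b powr (1 / p) * r ^ k * norm x"
      using norm_J_le[of "w k"] by (simp add: w_def mult_ac)
  qed (use r in auto)
  show ?thesis
    by (rule decayingI[OF r _ step]) auto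
qed

lemma integral_bound_imp_decaying:
  assumes "1 \<le> p" "0 < b"
    and cost: "\<And>\<sigma> x. \<sigma> \<in> range_seqs Tmin Tmax \<Longrightarrow>
      trajectory_cost S J p \<sigma> 0 x \<le> ennreal (b powr p * norm x powr p)"
  shows decaying
proof (rule summable_left_states_imp_decaying)
  fix d x and n :: nat assume d: "d \<in> dwell Tmin Tmax"
  obtain \<sigma> where \<sigma>: "\<sigma> \<in> range_seqs Tmin Tmax" "\<sigma> \<in> impulse_seqs" "jump_grid \<sigma> 0 \<sigma>" "gaps \<sigma> = d"
    using full_dwell_grid[OF d] .
  have d_le: "d k \<le> Tmax" for k using d by (simp add: dwell_full_iff)
  have "ennreal (\<Sum>k<n. norm (S (d k) (post_jump d k x)) powr p) \<le>
      ennreal (\<Sum>k<n. stage p (d k) (post_jump d k x))"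
    using assms d_le by (intro ennreal_leI sum_mono stage_ge_endpoint) auto
  also have "\<dots> = (\<Sum>k<n. ennreal (stage p (d k) (post_jump d k x)))"
    using assms d_le by (intro sum_ennreal[symmetric] stage_nonneg) auto
  also have "\<dots> \<le> gap_cost p d x"
    unfolding gap_cost_def by (rule sum_le_suminf) auto
  also have "\<dots> = trajectory_cost S J p \<sigma> 0 x"
    using trajectory_cost_on_grid[OF \<sigma>(2,3)] \<sigma>(4) d_le assms(1) by simp
  also have "\<dots> \<le> ennreal (b powr p * norm x powr p)" by (rule cost[OF \<sigma>(1)])
  finally show "(\<Sum>k<n. norm (S (d k) (post_jump d k x)) powr p) \<le> b powr p * norm x powr p"
    by (subst (asm) ennreal_le_iff) auto
qed (use assms in auto)

text \<open>
  A function that loses at least \<open>\<parallel>w\<parallel>\<^sup>p\<close> between consecutive left limits \<open>w\<close> bounds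
  the sum of these losses by its initial value.
\<close>

lemma discrete_lyapunov_imp_decaying:
  assumes "1 \<le> p" "0 < c" and V: "discrete_lyapunov S J Tmin Tmax p c V"
  shows decaying
proof (rule summable_left_states_imp_decaying)
  fix d x and n :: nat assume d: "d \<in> dwell Tmin Tmax"
  define w where "w k = S (d k) (post_jump d k x)" for k
  have w_Suc: "w (Suc k) = S (d (Suc k)) (J (w k))" for k by (simp add: w_def)
  have "(\<Sum>k<n. norm (w k) powr p) \<le> (\<Sum>k<n. V (w k) - V (w (Suc k)))"
  proof (rule sum_mono)
    fix k
    have "d (Suc k) \<in> {Tmin..Tmax}" using d by (simp add: dwell_def)
    then have "V (S (d (Suc k)) (J (w k))) - V (w k) \<le> - (norm (w k) powr p)"
      using V unfolding discrete_lyapunov_def by blast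
    then show "norm (w k) powr p \<le> V (w k) - V (w (Suc k))" unfolding w_Suc by simp
  qed
  also have "\<dots> = V (w 0) - V (w n)" by (rule sum_lessThan_telescope')
  also have "\<dots> \<le> c * norm (w 0) powr p"
    using V unfolding discrete_lyapunov_def by (smt (verit))
  also have "\<dots> \<le> c * (C * norm x) powr p"
    using assms d norm_S_le[of "d 0" x] Tmin_pos
    by (intro mult_left_mono powr_mono2) (auto simp: w_def dwell_def)
  also have "\<dots> = c * C powr p * norm x powr p"
    using C_ge_1 by (simp add: powr_mult)
  finally show "(\<Sum>k<n. norm (S (d k) (post_jump d k x)) powr p) \<le> c * C powr p * norm x powr p"
    by (simp add: w_def)
qed (use assms in auto)

text \<open>
  Along the free flow the timer functional does not increase, by the Dini condition; the loss
  \<open>\<parallel>w\<parallel>\<^sup>p\<close> comes from the jump condition alone.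
\<close>

lemma timer_lyapunov_flow_decreasing:
  assumes V: "timer_lyapunov S J Tmin Tmax p c V" and d: "0 \<le> d" "d \<le> Tmax"
  shows "V d (S d x) \<le> V 0 x"
proof -
  have lip: "lipschitz_on_bounded {0..Tmax} V"
    and contV: "\<And>x. continuous_on {0..Tmax} (\<lambda>\<tau>. V \<tau> x)"
    and dini: "\<And>\<tau> x. \<tau> \<in> {0..<Tmax} \<Longrightarrow> lower_dini S V \<tau> x \<le> ereal (- (norm x powr p))"
    using V unfolding timer_lyapunov_def by blast+
  have "V d (S d x) \<le> V 0 (S 0 x)"
  proof (rule lower_dini_nonpos_imp_decreasing[where \<phi> = "\<lambda>t. V t (S t x)", OF d(1)])
    show "continuous_on {0..d} (\<lambda>t. V t (S t x))"
    proof (rule continuous_on_subset)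
      show "continuous_on {0..Tmax} (\<lambda>t. V t (S t x))"
        unfolding continuous_on_def
      proof
        fix t assume t: "t \<in> {0..Tmax}"
        let ?F = "at t within {0..Tmax}"
        define R where "R = C * norm x + 1"
        have R: "norm (S \<tau> x) < R" if "\<tau> \<in> {0..Tmax}" for \<tau>
          using norm_S_le[of \<tau> x] that by (simp add: R_def)
        then have "0 < R" using t norm_ge_zero le_less_trans by blast
        then obtain L where L: "\<And>\<tau> y z. \<tau> \<in> {0..Tmax} \<Longrightarrow> norm y < R \<Longrightarrow> norm z < R \<Longrightarrow>
            \<bar>V \<tau> y - V \<tau> z\<bar> \<le> L * norm (y - z)"
          using lip unfolding lipschitz_on_bounded_def by blast
        have S_lim: "((\<lambda>\<tau>. S \<tau> x) \<longlongrightarrow> S t x) ?F"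
          using S_continuous[of x] t by (auto simp: continuous_on_def)
        have "((\<lambda>\<tau>. V \<tau> (S \<tau> x) - V \<tau> (S t x)) \<longlongrightarrow> 0) ?F"
        proof (rule Lim_null_comparison)
          show "\<forall>\<^sub>F \<tau> in ?F. norm (V \<tau> (S \<tau> x) - V \<tau> (S t x)) \<le> L * norm (S \<tau> x - S t x)"
            unfolding eventually_at_filter using L R t by (auto intro!: always_eventually)
          have "((\<lambda>\<tau>. L * norm (S \<tau> x - S t x)) \<longlongrightarrow> L * norm (S t x - S t x)) ?F"
            by (intro tendsto_intros S_lim)
          then show "((\<lambda>\<tau>. L * norm (S \<tau> x - S t x)) \<longlongrightarrow> 0) ?F" by simp
        qed
        moreover have "((\<lambda>\<tau>. V \<tau> (S t x)) \<longlongrightarrow> V t (S t x)) ?F"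
          using contV t by (auto simp: continuous_on_def)
        ultimately have "((\<lambda>\<tau>. (V \<tau> (S \<tau> x) - V \<tau> (S t x)) + V \<tau> (S t x)) \<longlongrightarrow> 0 + V t (S t x)) ?F"
          by (rule tendsto_add)
        then show "((\<lambda>\<tau>. V \<tau> (S \<tau> x)) \<longlongrightarrow> V t (S t x)) ?F" by simp
      qed
    qed (use d in auto)
    fix t assume t: "0 \<le> t" "t < d"
    have "\<forall>\<^sub>F h in at_right 0.
        ereal ((V (t + h) (S (t + h) x) - V t (S t x)) / h) =
        ereal ((V (t + h) (S h (S t x)) - V t (S t x)) / h)"
      using eventually_at_right_less
    proof eventually_elim
      case (elim h)
      then show ?case using S_add[of h t x] t by (simp add: add.commute)
    qed
    then have "Liminf (at_right 0) (\<lambda>h. ereal ((V (t + h) (S (t + h) x) - V t (S t x)) / h)) =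
        lower_dini S V t (S t x)"
      unfolding lower_dini_def by (rule Liminf_eq)
    also have "\<dots> \<le> ereal (- (norm (S t x) powr p))" using t d by (intro dini) auto
    also have "\<dots> \<le> 0" by simp
    finally show "Liminf (at_right 0) (\<lambda>h. ereal ((V (t + h) (S (t + h) x) - V t (S t x)) / h)) \<le> 0" .
  qed
  then show ?thesis by simp
qed

lemma timer_lyapunov_imp_decaying:
  assumes "1 \<le> p" "0 < c" and V: "timer_lyapunov S J Tmin Tmax p c V"
  shows decaying
proof (rule summable_left_states_imp_decaying)
  fix d x and n :: nat assume d: "d \<in> dwell Tmin Tmax"
  define y where "y k = post_jump d k x" for k
  have Tmax: "0 \<le> Tmax" using Tmin_pos Tmin_le by simp
  have "(\<Sum>k<n. norm (S (d k) (y k)) powr p) \<le> (\<Sum>k<n. V 0 (y k) - V 0 (y (Suc k)))"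
  proof (rule sum_mono)
    fix k
    have dk: "d k \<in> {Tmin..Tmax}" using d by (simp add: dwell_full_iff)
    then have "V 0 (J (S (d k) (y k))) - V (d k) (S (d k) (y k)) \<le> - (norm (S (d k) (y k)) powr p)"
      using V unfolding timer_lyapunov_def by blast
    moreover have "V (d k) (S (d k) (y k)) \<le> V 0 (y k)"
      using dk Tmin_pos by (intro timer_lyapunov_flow_decreasing[OF V]) auto
    moreover have "y (Suc k) = J (S (d k) (y k))" by (simp add: y_def)
    ultimately show "norm (S (d k) (y k)) powr p \<le> V 0 (y k) - V 0 (y (Suc k))" by simp
  qed
  also have "\<dots> = V 0 (y 0) - V 0 (y n)" by (rule sum_lessThan_telescope')
  also have "\<dots> \<le> V 0 (y 0)"
    using V Tmax unfolding timer_lyapunov_def by simp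
  also have "\<dots> \<le> c * norm (y 0) powr p"
    using V Tmax unfolding timer_lyapunov_def by simp
  finally show "(\<Sum>k<n. norm (S (d k) (post_jump d k x)) powr p) \<le> c * norm x powr p"
    by (simp add: y_def)
qed (use assms in auto)

end

section \<open>The supremum functional under geometric decay\<close>

lemma cSUP_le_cSUP_plus:
  fixes f :: "'a \<Rightarrow> real" and g :: "'b \<Rightarrow> real"
  assumes "A \<noteq> {}" "bdd_above (g ` B)" "\<And>a. a \<in> A \<Longrightarrow> \<exists>b\<in>B. f a \<le> g b + e"
  shows "(SUP a\<in>A. f a) \<le> (SUP b\<in>B. g b) + e"
proof (rule cSUP_least[OF assms(1)])
  fix a assume "a \<in> A"
  then obtain b where "b \<in> B" "f a \<le> g b + e" using assms(3) by blast
  then show "f a \<le> (SUP b\<in>B. g b) + e" using cSUP_upper[OF _ assms(2)] by fastforce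
qed

context impulsive_flow
begin

lemma stage_le:
  assumes p: "0 < p" and \<theta>: "0 \<le> \<theta>" "\<theta> \<le> Tmax"
  shows "stage p \<theta> y \<le> (Tmax + 1) * (C * norm y) powr p"
proof -
  have pointwise: "norm (S r y) powr p \<le> (C * norm y) powr p" if "0 \<le> r" "r \<le> Tmax" for r
    using norm_S_le[OF that, of y] p by (intro powr_mono2) auto
  have "integral {0..\<theta>} (\<lambda>r. norm (S r y) powr p) \<le> integral {0..\<theta>} (\<lambda>r. (C * norm y) powr p)"
    using p \<theta> pointwise by (intro integral_le norm_S_powr_integrable) auto
  also have "\<dots> \<le> Tmax * (C * norm y) powr p"
    using \<theta> by (simp add: mult_right_mono)
  finally show ?thesis
    using pointwise[of \<theta>] \<theta> by (simp add: stage_def algebra_simps)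
qed

lemma stage_lipschitz:
  assumes p: "1 \<le> p" and \<theta>: "0 \<le> \<theta>" "\<theta> \<le> Tmax" and R: "norm y \<le> R" "norm z \<le> R"
  shows "\<bar>stage p \<theta> y - stage p \<theta> z\<bar> \<le> (Tmax + 1) * (p * (C * R) powr (p - 1) * C) * norm (y - z)"
proof -
  define B where "B = p * (C * R) powr (p - 1) * C * norm (y - z)"
  have pointwise: "\<bar>norm (S r y) powr p - norm (S r z) powr p\<bar> \<le> B" if r: "0 \<le> r" "r \<le> Tmax" for r
  proof -
    have "norm (S r y) \<le> C * R" "norm (S r z) \<le> C * R"
      using norm_S_le[OF r] R C_ge_1 by (meson mult_left_mono order_trans zero_le_one)+
    then have "\<bar>norm (S r y) powr p - norm (S r z) powr p\<bar>
        \<le> p * (C * R) powr (p - 1) * \<bar>norm (S r y) - norm (S r z)\<bar>"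
      using p by (intro powr_lipschitz) auto
    also have "\<dots> \<le> p * (C * R) powr (p - 1) * (C * norm (y - z))"
    proof (rule mult_left_mono)
      have "\<bar>norm (S r y) - norm (S r z)\<bar> \<le> norm (S r (y - z))"
        unfolding blinfun.diff_right by (rule norm_triangle_ineq3)
      then show "\<bar>norm (S r y) - norm (S r z)\<bar> \<le> C * norm (y - z)"
        using norm_S_le[OF r, of "y - z"] by simp
    qed (use p in auto)
    finally show ?thesis by (simp add: B_def)
  qed
  have "0 \<le> B" using p C_ge_1 by (simp add: B_def)
  let ?g = "\<lambda>r. norm (S r y) powr p - norm (S r z) powr p"
  have "continuous_on {0..Tmax} ?g"
    using p by (intro continuous_on_diff norm_S_powr_continuous) auto
  then have "continuous_on {0..\<theta>} ?g"
    using \<theta> by (elim continuous_on_subset) auto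
  then have "norm (integral {0..\<theta>} ?g) \<le> B * (\<theta> - 0)"
    using \<theta> pointwise by (intro integral_bound) auto
  also have "\<dots> \<le> B * Tmax" using \<theta> \<open>0 \<le> B\<close> by (simp add: mult_left_mono)
  also have "integral {0..\<theta>} ?g =
      integral {0..\<theta>} (\<lambda>r. norm (S r y) powr p) - integral {0..\<theta>} (\<lambda>r. norm (S r z) powr p)"
    using p \<theta> by (intro integral_diff norm_S_powr_integrable) auto
  finally have "\<bar>stage p \<theta> y - stage p \<theta> z\<bar> \<le> B * Tmax + B"
    using pointwise[OF \<theta>] unfolding stage_def real_norm_def by linarith
  then show ?thesis by (simp add: B_def algebra_simps)
qed

lemma stage_continuous:
  assumes "0 < p"
  shows "continuous_on {0..Tmax} (\<lambda>\<theta>. stage p \<theta> y)"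
  unfolding stage_def using assms
  by (intro continuous_on_add indefinite_integral_continuous_1 norm_S_powr_integrable
      norm_S_powr_continuous) auto

text \<open>
  The integral that separates the two stages is what makes the supremum functional decrease at the
  rate \<open>\<parallel>x\<parallel>\<^sup>p\<close> along the free flow.
\<close>

lemma stage_prolong:
  assumes "0 < p" "0 \<le> h" "0 \<le> \<theta>" "\<theta> + h \<le> Tmax"
  shows "stage p (\<theta> + h) x = integral {0..h} (\<lambda>r. norm (S r x) powr p) + stage p \<theta> (S h x)"
proof -
  let ?f = "\<lambda>r. norm (S r x) powr p"
  have "integral {0..\<theta> + h} ?f = integral {0..h} ?f + integral {h..\<theta> + h} ?f"
    using assms
    by (intro Henstock_Kurzweil_Integration.integral_combine[symmetric] norm_S_powr_integrable) auto
  also have "integral {h..\<theta> + h} ?f = integral {0..\<theta>} (?f \<circ> (+) h)"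
    by (simp add: integral_shift_Icc_real)
  also have "\<dots> = integral {0..\<theta>} (\<lambda>r. norm (S r (S h x)) powr p)"
    using assms S_add[of _ h x] by (intro integral_cong) (auto simp: add.commute)
  finally show ?thesis
    using assms S_add[of \<theta> h x] by (simp add: stage_def)
qed

end

locale decaying_flow = impulsive_flow +
  fixes K r p :: real
  assumes K_ge_1: "1 \<le> K" and r_pos: "0 < r" and r_less_1: "r < 1" and p_ge_1: "1 \<le> p"
    and decay: "\<And>d k. d \<in> dwell 0 Tmax \<Longrightarrow> norm (post_jump d k) \<le> K * r ^ k"
begin

lemma p_pos: "0 < p" using p_ge_1 by simp

lemma Tmax_pos: "0 < Tmax" using Tmin_pos Tmin_le by simp

lemma norm_post_jump_le:
  assumes "d \<in> dwell 0 Tmax"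
  shows "norm (post_jump d k x) \<le> K * r ^ k * norm x"
  using norm_blinfun[of "post_jump d k" x] decay[OF assms, of k]
  by (meson mult_right_mono norm_ge_zero order_trans)

definition total_cost :: "(nat \<Rightarrow> real) \<Rightarrow> 'a \<Rightarrow> real" where
  "total_cost d x = (\<Sum>k. stage p (d k) (post_jump d k x))"

definition cost_bound :: real where
  "cost_bound = (Tmax + 1) * (C * K) powr p / (1 - r)"

definition cost_lipschitz :: "real \<Rightarrow> real" where
  "cost_lipschitz R = (Tmax + 1) * (p * (C * (K * R)) powr (p - 1) * C) * K / (1 - r)"

lemma cost_bound_pos: "0 < cost_bound"
  unfolding cost_bound_def using Tmax_pos C_ge_1 K_ge_1 r_less_1 by (intro divide_pos_pos mult_pos_pos) auto

lemma cost_lipschitz_nonneg: "0 \<le> cost_lipschitz R"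
  unfolding cost_lipschitz_def using Tmax_pos C_ge_1 K_ge_1 r_less_1 p_ge_1 by simp

text \<open>
  The power \<open>(r ^ k) powr p\<close> may be replaced by \<open>r ^ k\<close> because \<open>p \<ge> 1\<close>; this keeps one
  geometric series for all estimates below.
\<close>

lemma stage_post_jump_le:
  assumes d: "d \<in> dwell 0 Tmax"
  shows "stage p (d k) (post_jump d k x) \<le> (Tmax + 1) * (C * K) powr p * norm x powr p * r ^ k"
proof -
  have "stage p (d k) (post_jump d k x) \<le> (Tmax + 1) * (C * norm (post_jump d k x)) powr p"
    using dwell_nth[OF d] p_pos by (intro stage_le) auto
  also have "\<dots> \<le> (Tmax + 1) * (C * (K * r ^ k * norm x)) powr p"
    using norm_post_jump_le[OF d] C_ge_1 Tmax_pos p_pos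
    by (intro mult_left_mono powr_mono2) auto
  also have "\<dots> = (Tmax + 1) * (C * K) powr p * norm x powr p * (r ^ k) powr p"
    using C_ge_1 K_ge_1 r_pos by (simp add: powr_mult mult_ac)
  also have "\<dots> \<le> (Tmax + 1) * (C * K) powr p * norm x powr p * (r ^ k) powr 1"
    using r_pos r_less_1 p_ge_1 Tmax_pos
    by (intro mult_left_mono powr_mono') (auto simp: power_le_one)
  finally show ?thesis using r_pos by simp
qed

lemma stage_post_jump_nonneg: "d \<in> dwell 0 Tmax \<Longrightarrow> 0 \<le> stage p (d k) (post_jump d k x)"
  using dwell_nth p_pos by (intro stage_nonneg) auto

lemma geometric: "summable (\<lambda>k. a * r ^ k)" "(\<Sum>k. a * r ^ k) = a / (1 - r)"
proof -
  have "\<bar>r\<bar> < 1" using r_pos r_less_1 by simp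
  then show "summable (\<lambda>k. a * r ^ k)" "(\<Sum>k. a * r ^ k) = a / (1 - r)"
    by (auto simp: suminf_mult suminf_geometric summable_geometric divide_inverse)
qed

lemma summable_stages:
  assumes "d \<in> dwell 0 Tmax"
  shows "summable (\<lambda>k. stage p (d k) (post_jump d k x))"
  using stage_post_jump_nonneg[OF assms] stage_post_jump_le[OF assms]
  by (intro summable_comparison_test'[OF geometric(1), of 0]) auto

lemma total_cost_nonneg: "d \<in> dwell 0 Tmax \<Longrightarrow> 0 \<le> total_cost d x"
  unfolding total_cost_def using summable_stages stage_post_jump_nonneg by (intro suminf_nonneg) auto

lemma gap_cost_eq_total_cost:
  assumes "d \<in> dwell 0 Tmax"
  shows "gap_cost p d x = ennreal (total_cost d x)"
  unfolding gap_cost_def total_cost_def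
  using stage_post_jump_nonneg[OF assms] summable_stages[OF assms] by (intro suminf_ennreal2) auto

lemma total_cost_le:
  assumes "d \<in> dwell 0 Tmax"
  shows "total_cost d x \<le> cost_bound * norm x powr p"
proof -
  have "total_cost d x \<le> (\<Sum>k. (Tmax + 1) * (C * K) powr p * norm x powr p * r ^ k)"
    unfolding total_cost_def
    using stage_post_jump_le[OF assms] summable_stages[OF assms] geometric(1) by (intro suminf_le) auto
  then show ?thesis by (simp add: geometric cost_bound_def)
qed

lemma total_cost_lipschitz:
  assumes d: "d \<in> dwell 0 Tmax" and R: "norm x \<le> R" "norm y \<le> R"
  shows "\<bar>total_cost d x - total_cost d y\<bar> \<le> cost_lipschitz R * norm (x - y)"
proof -
  define B where "B = (Tmax + 1) * (p * (C * (K * R)) powr (p - 1) * C)"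
  have "0 \<le> B" using Tmax_pos p_ge_1 C_ge_1 by (simp add: B_def)
  have small: "norm (post_jump d k z) \<le> K * R" if "norm z \<le> R" for k z
  proof -
    have "norm (post_jump d k z) \<le> K * r ^ k * norm z" by (rule norm_post_jump_le[OF d])
    also have "\<dots> \<le> K * 1 * R"
      using that K_ge_1 r_pos r_less_1 by (intro mult_mono) (auto simp: power_le_one)
    finally show ?thesis by simp
  qed
  have "\<bar>stage p (d k) (post_jump d k x) - stage p (d k) (post_jump d k y)\<bar>
      \<le> B * K * norm (x - y) * r ^ k" for k
  proof -
    have "\<bar>stage p (d k) (post_jump d k x) - stage p (d k) (post_jump d k y)\<bar>
        \<le> B * norm (post_jump d k x - post_jump d k y)"
      unfolding B_def using dwell_nth[OF d] p_ge_1 small R by (intro stage_lipschitz) auto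
    also have "\<dots> \<le> B * (K * r ^ k * norm (x - y))"
      using norm_post_jump_le[OF d, of k "x - y"] \<open>0 \<le> B\<close>
      by (intro mult_left_mono) (auto simp: blinfun.diff_right)
    finally show ?thesis by (simp add: mult_ac)
  qed
  then have "norm (\<Sum>k. stage p (d k) (post_jump d k x) - stage p (d k) (post_jump d k y))
      \<le> (\<Sum>k. B * K * norm (x - y) * r ^ k)"
    by (intro norm_suminf_le geometric) auto
  then show ?thesis
    unfolding total_cost_def suminf_diff[OF summable_stages[OF d] summable_stages[OF d]] geometric
    by (simp add: cost_lipschitz_def B_def)
qed

lemma total_cost_front:
  assumes "d \<in> dwell 0 Tmax"
  shows "total_cost d x = stage p (d 0) x + total_cost (\<lambda>k. d (Suc k)) (J (S (d 0) x))"
  using suminf_split_head[OF summable_stages[OF assms, of x]]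
  unfolding total_cost_def post_jump_front by simp

definition timer_sup :: "real \<Rightarrow> 'a \<Rightarrow> real" where
  "timer_sup \<tau> x = (SUP d\<in>timer_dwell \<tau>. total_cost d x)"

lemma timer_dwell_subset: "0 \<le> \<tau> \<Longrightarrow> timer_dwell \<tau> \<subseteq> dwell 0 Tmax"
  by (rule dwell_subset) auto

lemma timer_dwell_nonempty:
  assumes "\<tau> \<in> {0..Tmax}"
  shows "timer_dwell \<tau> \<noteq> {}"
proof -
  have "(\<lambda>k. if k = 0 then Tmax - \<tau> else Tmax) \<in> timer_dwell \<tau>"
    using assms Tmin_le by (auto simp: dwell_def)
  then show ?thesis by blast
qed

lemma total_cost_bdd_above:
  assumes "0 \<le> \<tau>"
  shows "bdd_above ((\<lambda>d. total_cost d x) ` timer_dwell \<tau>)"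
  using total_cost_le timer_dwell_subset[OF assms] by (intro bdd_aboveI2) blast

lemma total_cost_le_timer_sup:
  assumes "0 \<le> \<tau>" "d \<in> timer_dwell \<tau>"
  shows "total_cost d x \<le> timer_sup \<tau> x"
  unfolding timer_sup_def using assms(2) by (rule cSUP_upper[OF _ total_cost_bdd_above[OF assms(1)]])

lemma timer_sup_nonneg:
  assumes "\<tau> \<in> {0..Tmax}"
  shows "0 \<le> timer_sup \<tau> x"
proof -
  obtain d where d: "d \<in> timer_dwell \<tau>" using timer_dwell_nonempty[OF assms] by blast
  then have "0 \<le> total_cost d x" using timer_dwell_subset[of \<tau>] assms by (intro total_cost_nonneg) auto
  then show ?thesis using total_cost_le_timer_sup[OF _ d, of x] assms by simp
qed

lemma timer_sup_le:
  assumes "\<tau> \<in> {0..Tmax}"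
  shows "timer_sup \<tau> x \<le> cost_bound * norm x powr p"
  unfolding timer_sup_def using timer_dwell_nonempty[OF assms]
proof (rule cSUP_least)
  fix d assume "d \<in> timer_dwell \<tau>"
  then show "total_cost d x \<le> cost_bound * norm x powr p"
    using timer_dwell_subset[of \<tau>] assms by (intro total_cost_le) auto
qed

lemma sup_functional_eq_timer_sup:
  assumes "\<tau> \<in> {0..Tmax}"
  shows "sup_functional S J Tmin Tmax p \<tau> x = ennreal (timer_sup \<tau> x)"
proof -
  have sub: "timer_dwell \<tau> \<subseteq> dwell 0 Tmax" using assms by (intro timer_dwell_subset) auto
  have "sup_functional S J Tmin Tmax p \<tau> x = (SUP d\<in>timer_dwell \<tau>. ennreal (total_cost d x))"
    using assms p_pos sub gap_cost_eq_total_cost by (subst sup_functional_eq) (auto intro!: SUP_cong)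
  also have "\<dots> = ennreal (timer_sup \<tau> x)" (is "?U = _")
  proof (rule antisym)
    show "?U \<le> ennreal (timer_sup \<tau> x)"
      using assms by (intro SUP_least ennreal_leI total_cost_le_timer_sup) auto
    then have finite: "?U < top" using ennreal_less_top le_less_trans by blast
    have "timer_sup \<tau> x \<le> enn2real ?U"
      unfolding timer_sup_def
    proof (rule cSUP_least[OF timer_dwell_nonempty[OF assms]])
      fix d assume d: "d \<in> timer_dwell \<tau>"
      then have "enn2real (ennreal (total_cost d x)) \<le> enn2real ?U"
        by (intro enn2real_mono SUP_upper finite)
      then show "total_cost d x \<le> enn2real ?U"
        using total_cost_nonneg[of d x] d sub by auto
    qed
    then have "ennreal (timer_sup \<tau> x) \<le> ennreal (enn2real ?U)" by (rule ennreal_leI)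
    also have "\<dots> = ?U" using finite by simp
    finally show "ennreal (timer_sup \<tau> x) \<le> ?U" .
  qed
  finally show ?thesis .
qed

lemma timer_sup_lipschitz:
  assumes \<tau>: "\<tau> \<in> {0..Tmax}" and R: "norm x \<le> R" "norm y \<le> R"
  shows "\<bar>timer_sup \<tau> x - timer_sup \<tau> y\<bar> \<le> cost_lipschitz R * norm (x - y)"
proof -
  have half: "timer_sup \<tau> v \<le> timer_sup \<tau> w + cost_lipschitz R * norm (v - w)"
    if "norm v \<le> R" "norm w \<le> R" for v w
    unfolding timer_sup_def
  proof (rule cSUP_le_cSUP_plus[OF timer_dwell_nonempty[OF \<tau>]])
    show "bdd_above ((\<lambda>d. total_cost d w) ` timer_dwell \<tau>)"
      using \<tau> by (intro total_cost_bdd_above) auto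
    fix d assume d: "d \<in> timer_dwell \<tau>"
    then have "d \<in> dwell 0 Tmax" using timer_dwell_subset[of \<tau>] \<tau> by auto
    from total_cost_lipschitz[OF this that]
    have "total_cost d v \<le> total_cost d w + cost_lipschitz R * norm (v - w)" by linarith
    then show "\<exists>d'\<in>timer_dwell \<tau>. total_cost d v \<le> total_cost d' w + cost_lipschitz R * norm (v - w)"
      using d by blast
  qed
  show ?thesis
    using half[OF R] half[OF R(2,1)] by (simp add: norm_minus_commute abs_le_iff)
qed

text \<open>
  The admissible first waiting times for \<open>\<tau>\<close> form an interval whose endpoints move at speed at
  most one in \<open>\<tau>\<close>. Moving the first waiting time of a sequence to the nearest admissible value
  changes the total cost by an amount that is small uniformly in the remaining waiting times.
\<close>

lemma timer_sup_continuous: "continuous_on {0..Tmax} (\<lambda>\<tau>. timer_sup \<tau> x)"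
proof -
  define R where "R = norm J * (C * norm x)"
  define L where "L = cost_lipschitz R * norm J"
  have "0 \<le> L" by (simp add: L_def cost_lipschitz_nonneg)
  have tail_small: "norm (J (S \<theta> x)) \<le> R" if "\<theta> \<in> {0..Tmax}" for \<theta>
    unfolding R_def using norm_J_le[of "S \<theta> x"] norm_S_le[of \<theta> x] that
    by (meson atLeastAtMost_iff mult_left_mono norm_ge_zero order_trans)
  have unif: "uniformly_continuous_on {0..Tmax} (\<lambda>\<theta>. stage p \<theta> x)"
    "uniformly_continuous_on {0..Tmax} (\<lambda>\<theta>. S \<theta> x)"
    using stage_continuous[OF p_pos] S_continuous by (auto intro!: compact_uniformly_continuous)
  have close: "\<exists>\<delta>>0. \<forall>\<theta>\<in>{0..Tmax}. \<forall>\<theta>'\<in>{0..Tmax}. \<bar>\<theta> - \<theta>'\<bar> < \<delta> \<longrightarrow>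
      (\<forall>d\<in>dwell Tmin Tmax. stage p \<theta> x + total_cost d (J (S \<theta> x))
        \<le> stage p \<theta>' x + total_cost d (J (S \<theta>' x)) + \<epsilon>)" if "\<epsilon> > 0" for \<epsilon>
  proof -
    obtain \<delta>1 where \<delta>1: "\<delta>1 > 0" "\<And>\<theta> \<theta>'. \<theta> \<in> {0..Tmax} \<Longrightarrow> \<theta>' \<in> {0..Tmax} \<Longrightarrow>
        \<bar>\<theta> - \<theta>'\<bar> < \<delta>1 \<Longrightarrow> \<bar>stage p \<theta> x - stage p \<theta>' x\<bar> < \<epsilon> / 2"
      using unif(1) half_gt_zero[OF \<open>\<epsilon> > 0\<close>] unfolding uniformly_continuous_on_def dist_real_def
      by (metis abs_minus_commute)
    have "0 < \<epsilon> / (2 * (L + 1))" using \<open>\<epsilon> > 0\<close> \<open>0 \<le> L\<close> by simp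
    then obtain \<delta>2 where \<delta>2: "\<delta>2 > 0" "\<And>\<theta> \<theta>'. \<theta> \<in> {0..Tmax} \<Longrightarrow> \<theta>' \<in> {0..Tmax} \<Longrightarrow>
        \<bar>\<theta> - \<theta>'\<bar> < \<delta>2 \<Longrightarrow> norm (S \<theta> x - S \<theta>' x) < \<epsilon> / (2 * (L + 1))"
      using unif(2) unfolding uniformly_continuous_on_def dist_real_def dist_norm
      by (metis abs_minus_commute norm_minus_commute)
    show ?thesis
    proof (intro exI[of _ "min \<delta>1 \<delta>2"] conjI ballI impI)
      fix \<theta> \<theta>' d
      assume \<theta>: "\<theta> \<in> {0..Tmax}" "\<theta>' \<in> {0..Tmax}" "\<bar>\<theta> - \<theta>'\<bar> < min \<delta>1 \<delta>2"
        and d: "d \<in> dwell Tmin Tmax"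
      have "d \<in> dwell 0 Tmax" using d Tmin_pos by (auto simp: dwell_def)
      then have "\<bar>total_cost d (J (S \<theta> x)) - total_cost d (J (S \<theta>' x))\<bar>
          \<le> cost_lipschitz R * norm (J (S \<theta> x) - J (S \<theta>' x))"
        using tail_small \<theta> by (intro total_cost_lipschitz) auto
      also have "\<dots> \<le> cost_lipschitz R * (norm J * norm (S \<theta> x - S \<theta>' x))"
        using norm_J_le[of "S \<theta> x - S \<theta>' x"]
        by (intro mult_left_mono cost_lipschitz_nonneg) (simp add: blinfun.diff_right)
      also have "\<dots> \<le> L * (\<epsilon> / (2 * (L + 1)))"
        unfolding L_def mult.assoc[symmetric] using \<delta>2(2)[OF \<theta>(1,2)] \<theta>(3) \<open>0 \<le> L\<close>
        by (intro mult_left_mono) (auto simp: L_def)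
      also have "\<dots> \<le> \<epsilon> / 2"
        using \<open>0 \<le> L\<close> \<open>\<epsilon> > 0\<close> by (simp add: field_simps)
      finally show "stage p \<theta> x + total_cost d (J (S \<theta> x))
          \<le> stage p \<theta>' x + total_cost d (J (S \<theta>' x)) + \<epsilon>"
        using \<delta>1(2)[OF \<theta>(1,2)] \<theta>(3) by linarith
    qed (use \<delta>1 \<delta>2 in auto)
  qed
  show ?thesis
    unfolding continuous_on_iff
  proof (intro ballI allI impI)
    fix \<tau> \<epsilon> :: real assume \<tau>: "\<tau> \<in> {0..Tmax}" and "\<epsilon> > 0"
    obtain \<delta> where \<delta>: "\<delta> > 0" "\<And>\<theta> \<theta>' d. \<theta> \<in> {0..Tmax} \<Longrightarrow> \<theta>' \<in> {0..Tmax} \<Longrightarrow> \<bar>\<theta> - \<theta>'\<bar> < \<delta> \<Longrightarrow>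
        d \<in> dwell Tmin Tmax \<Longrightarrow> stage p \<theta> x + total_cost d (J (S \<theta> x))
          \<le> stage p \<theta>' x + total_cost d (J (S \<theta>' x)) + \<epsilon> / 2"
      using close[of "\<epsilon> / 2"] \<open>\<epsilon> > 0\<close> by (metis half_gt_zero)
    have half: "timer_sup \<tau>1 x \<le> timer_sup \<tau>2 x + \<epsilon> / 2"
      if \<tau>12: "\<tau>1 \<in> {0..Tmax}" "\<tau>2 \<in> {0..Tmax}" "\<bar>\<tau>1 - \<tau>2\<bar> < \<delta>" for \<tau>1 \<tau>2
      unfolding timer_sup_def
    proof (rule cSUP_le_cSUP_plus[OF timer_dwell_nonempty[OF \<tau>12(1)]])
      show "bdd_above ((\<lambda>d. total_cost d x) ` timer_dwell \<tau>2)"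
        using \<tau>12 by (intro total_cost_bdd_above) auto
      fix d assume d: "d \<in> timer_dwell \<tau>1"
      define \<theta> where "\<theta> = max (max (Tmin - \<tau>2) 0) (min (d 0) (Tmax - \<tau>2))"
      have d0: "max (Tmin - \<tau>1) 0 \<le> d 0" "d 0 \<le> Tmax - \<tau>1" using d by (auto simp: dwell_def)
      have \<theta>: "max (Tmin - \<tau>2) 0 \<le> \<theta>" "\<theta> \<le> Tmax - \<tau>2"
        using \<tau>12 Tmin_le by (auto simp: \<theta>_def)
      have near: "\<bar>d 0 - \<theta>\<bar> < \<delta>"
        using d0 \<tau>12(3) \<open>\<delta> > 0\<close> unfolding \<theta>_def by linarith
      let ?d = "\<lambda>k. d (Suc k)" and ?d' = "d(0 := \<theta>)"
      have d': "?d' \<in> timer_dwell \<tau>2" using d \<theta> by (auto simp: dwell_def)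
      have "total_cost d x = stage p (d 0) x + total_cost ?d (J (S (d 0) x))"
        using d \<tau>12 timer_dwell_subset[of \<tau>1] by (intro total_cost_front) auto
      also have "\<dots> \<le> stage p \<theta> x + total_cost ?d (J (S \<theta> x)) + \<epsilon> / 2"
        using d0 \<theta> near \<tau>12 d by (intro \<delta>(2) dwell_shift[of d]) auto
      also have "stage p \<theta> x + total_cost ?d (J (S \<theta> x)) = total_cost ?d' x"
        using d' \<tau>12 timer_dwell_subset[of \<tau>2] by (subst total_cost_front) auto
      finally show "\<exists>d'\<in>timer_dwell \<tau>2. total_cost d x \<le> total_cost d' x + \<epsilon> / 2"
        using d' by blast
    qed
    show "\<exists>\<delta>>0. \<forall>\<tau>'\<in>{0..Tmax}. dist \<tau>' \<tau> < \<delta> \<longrightarrow> dist (timer_sup \<tau>' x) (timer_sup \<tau> x) < \<epsilon>"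
    proof (intro exI[of _ \<delta>] conjI ballI impI)
      fix \<tau>' assume \<tau>': "\<tau>' \<in> {0..Tmax}" "dist \<tau>' \<tau> < \<delta>"
      then have "\<bar>timer_sup \<tau>' x - timer_sup \<tau> x\<bar> \<le> \<epsilon> / 2"
        using half[OF \<tau> \<tau>'(1)] half[OF \<tau>'(1) \<tau>]
        unfolding dist_real_def abs_minus_commute[of \<tau>] by linarith
      then show "dist (timer_sup \<tau>' x) (timer_sup \<tau> x) < \<epsilon>" using \<open>\<epsilon> > 0\<close> by (simp add: dist_real_def)
    qed (use \<delta> in auto)
  qed
qed

text \<open>
  A waiting sequence for the advanced clock \<open>\<tau> + h\<close> becomes one for \<open>\<tau>\<close> when its first entry
  is prolonged by \<open>h\<close>; this embeds the trajectories from \<open>S h x\<close> into those from \<open>x\<close>.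
\<close>

lemma timer_sup_flow:
  assumes "0 \<le> \<tau>" "0 \<le> h" "\<tau> + h \<le> Tmax"
  shows "timer_sup (\<tau> + h) (S h x) \<le> timer_sup \<tau> x - integral {0..h} (\<lambda>r. norm (S r x) powr p)"
proof -
  have "timer_dwell (\<tau> + h) \<noteq> {}" using assms by (intro timer_dwell_nonempty) auto
  then show ?thesis
    unfolding timer_sup_def[of "\<tau> + h"]
  proof (rule cSUP_least)
    fix d assume d: "d \<in> timer_dwell (\<tau> + h)"
    let ?d = "d(0 := d 0 + h)"
    have d0: "0 \<le> d 0" "d 0 + h \<le> Tmax" using d assms by (auto simp: dwell_def)
    have d': "?d \<in> timer_dwell \<tau>" using d assms by (auto simp: dwell_def)
    have "total_cost ?d x = stage p (d 0 + h) x + total_cost (\<lambda>k. d (Suc k)) (J (S (d 0 + h) x))"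
      using d' timer_dwell_subset assms by (subst total_cost_front) auto
    also have "\<dots> = integral {0..h} (\<lambda>r. norm (S r x) powr p) +
        (stage p (d 0) (S h x) + total_cost (\<lambda>k. d (Suc k)) (J (S (d 0) (S h x))))"
      using stage_prolong[OF p_pos assms(2) d0] S_add[OF d0(1) assms(2)] by simp
    also have "stage p (d 0) (S h x) + total_cost (\<lambda>k. d (Suc k)) (J (S (d 0) (S h x))) =
        total_cost d (S h x)"
      using d timer_dwell_subset[of "\<tau> + h"] assms by (intro total_cost_front[symmetric]) auto
    finally show "total_cost d (S h x) \<le> timer_sup \<tau> x - integral {0..h} (\<lambda>r. norm (S r x) powr p)"
      using total_cost_le_timer_sup[OF assms(1) d', of x] by linarith
  qed
qed

lemma timer_sup_lower_dini:
  assumes \<tau>: "\<tau> \<in> {0..<Tmax}"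
  shows "lower_dini S timer_sup \<tau> x \<le> ereal (- (norm x powr p))"
proof -
  let ?f = "\<lambda>r. norm (S r x) powr p" and ?I = "\<lambda>h. integral {0..h} (\<lambda>r. norm (S r x) powr p)"
  have "(?I has_vector_derivative ?f 0) (at 0 within {0..Tmax})"
    using Tmax_pos by (intro integral_has_vector_derivative norm_S_powr_continuous p_pos) auto
  then have "(?I has_field_derivative ?f 0) (at_right 0)"
    using Tmax_pos
    by (simp add: at_within_Icc_at_right has_real_derivative_iff_has_vector_derivative)
  then have "((\<lambda>h. ?I h / h) \<longlongrightarrow> norm x powr p) (at_right 0)"
    by (simp add: has_field_derivative_iff)
  then have lim: "((\<lambda>h. ereal (- (?I h / h))) \<longlongrightarrow> ereal (- (norm x powr p))) (at_right 0)"
    by (intro tendsto_intros)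
  have "\<forall>\<^sub>F h in at_right 0. h \<in> {0<..<Tmax - \<tau>}"
    using \<tau> by (intro eventually_at_right_real) auto
  then have "\<forall>\<^sub>F h in at_right 0.
      ereal ((timer_sup (\<tau> + h) (S h x) - timer_sup \<tau> x) / h) \<le> ereal (- (?I h / h))"
  proof eventually_elim
    case (elim h)
    then have "timer_sup (\<tau> + h) (S h x) - timer_sup \<tau> x \<le> - ?I h"
      using timer_sup_flow[of \<tau> h x] \<tau> by auto
    then have "(timer_sup (\<tau> + h) (S h x) - timer_sup \<tau> x) / h \<le> - ?I h / h"
      using elim by (intro divide_right_mono) auto
    then show ?case by simp
  qed
  then have "lower_dini S timer_sup \<tau> x \<le> Liminf (at_right 0) (\<lambda>h. ereal (- (?I h / h)))"
    unfolding lower_dini_def by (rule Liminf_mono)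
  also have "\<dots> = ereal (- (norm x powr p))"
    using lim by (intro lim_imp_Liminf) auto
  finally show ?thesis .
qed

text \<open>
  One half of the dynamic programming principle. With \<open>\<theta> = 0\<close> it is the jump condition for the
  timer functional; with \<open>\<tau> = 0\<close> it yields the discrete functional.
\<close>

lemma timer_sup_ge_first_stage:
  assumes \<tau>: "0 \<le> \<tau>" and \<theta>: "\<theta> \<in> {max (Tmin - \<tau>) 0..Tmax - \<tau>}"
  shows "stage p \<theta> x + timer_sup 0 (J (S \<theta> x)) \<le> timer_sup \<tau> x"
proof -
  have "timer_sup 0 (J (S \<theta> x)) \<le> timer_sup \<tau> x - stage p \<theta> x"
    unfolding timer_sup_def[of 0]
  proof (rule cSUP_least)
    show "timer_dwell 0 \<noteq> {}" using Tmax_pos by (intro timer_dwell_nonempty) auto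
    fix d assume "d \<in> timer_dwell 0"
    then have d: "d \<in> dwell Tmin Tmax" using Tmin_pos by simp
    have d': "case_nat \<theta> d \<in> timer_dwell \<tau>"
      using d \<theta> by (simp add: dwell_def[of "max (Tmin - \<tau>) 0"] dwell_full_iff)
    then have "total_cost (case_nat \<theta> d) x = stage p \<theta> x + total_cost d (J (S \<theta> x))"
      using timer_dwell_subset[OF \<tau>] by (subst total_cost_front) auto
    then show "total_cost d (J (S \<theta> x)) \<le> timer_sup \<tau> x - stage p \<theta> x"
      using total_cost_le_timer_sup[OF \<tau> d', of x] by simp
  qed
  then show ?thesis by simp
qed

lemma timer_sup_jump:
  assumes "\<theta> \<in> {Tmin..Tmax}"
  shows "timer_sup 0 (J x) - timer_sup \<theta> x \<le> - (norm x powr p)"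
  using timer_sup_ge_first_stage[of \<theta> 0 x] assms Tmin_pos by simp

lemma timer_lyapunov_sup_functional:
  "timer_lyapunov S J Tmin Tmax p cost_bound
     (\<lambda>\<tau> x. enn2real (sup_functional S J Tmin Tmax p \<tau> x))" (is "timer_lyapunov S J _ _ _ _ ?V")
proof -
  have eq: "?V \<tau> x = timer_sup \<tau> x" if "\<tau> \<in> {0..Tmax}" for \<tau> x
    using sup_functional_eq_timer_sup[OF that] timer_sup_nonneg[OF that] by simp
  have "lipschitz_on_bounded {0..Tmax} ?V"
    unfolding lipschitz_on_bounded_def
  proof (intro allI impI)
    fix R :: real assume "R > 0"
    have "\<bar>?V \<tau> x - ?V \<tau> y\<bar> \<le> (cost_lipschitz R + 1) * norm (x - y)"
      if "\<tau> \<in> {0..Tmax}" "norm x < R" "norm y < R" for \<tau> x y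
      using timer_sup_lipschitz[of \<tau> x R y] that norm_ge_zero[of "x - y"]
      unfolding eq[OF that(1)] distrib_right by linarith
    then show "\<exists>L>0. \<forall>\<tau>\<in>{0..Tmax}. \<forall>x y. norm x < R \<longrightarrow> norm y < R \<longrightarrow>
        \<bar>?V \<tau> x - ?V \<tau> y\<bar> \<le> L * norm (x - y)"
      using cost_lipschitz_nonneg[of R] by (intro exI[of _ "cost_lipschitz R + 1"]) auto
  qed
  moreover have "continuous_on {0..Tmax} (\<lambda>\<tau>. ?V \<tau> x)" for x
    using timer_sup_continuous[of x] eq by (subst continuous_on_cong[OF refl]) auto
  moreover have "lower_dini S ?V \<tau> x \<le> ereal (- (norm x powr p))" if \<tau>: "\<tau> \<in> {0..<Tmax}" for \<tau> x
  proof -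
    have "\<forall>\<^sub>F h in at_right 0. h \<in> {0<..<Tmax - \<tau>}"
      using \<tau> by (intro eventually_at_right_real) auto
    then have "lower_dini S ?V \<tau> x = lower_dini S timer_sup \<tau> x"
      unfolding lower_dini_def
    proof (intro Liminf_eq, eventually_elim)
      case (elim h)
      then show ?case using eq[of "\<tau> + h"] eq[of \<tau>] \<tau> by simp
    qed
    then show ?thesis using timer_sup_lower_dini[OF \<tau>] by simp
  qed
  moreover have "?V 0 (J x) - ?V \<theta> x \<le> - (norm x powr p)" if "\<theta> \<in> {Tmin..Tmax}" for \<theta> x
    using timer_sup_jump[OF that] eq[of 0] eq[of \<theta>] that Tmin_pos by simp
  moreover have "0 \<le> ?V \<tau> x" "?V \<tau> x \<le> cost_bound * norm x powr p" if "\<tau> \<in> {0..Tmax}" for \<tau> x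
    using timer_sup_nonneg[OF that] timer_sup_le[OF that] eq[OF that] by auto
  ultimately show ?thesis unfolding timer_lyapunov_def by blast
qed

text \<open>
  The discrete functional lives on left limits: \<open>norm x powr p\<close> accounts for the current one and
  \<open>timer_sup 0 (J x)\<close> for everything after the jump.
\<close>

lemma discrete_lyapunov_timer_sup:
  "discrete_lyapunov S J Tmin Tmax p (1 + cost_bound * norm J powr p)
     (\<lambda>x. norm x powr p + timer_sup 0 (J x))" (is "discrete_lyapunov S J _ _ _ _ ?V")
proof -
  have zero: "0 \<in> {0..Tmax}" using Tmax_pos by simp
  have "\<exists>L>0. \<forall>x y. norm x < R \<longrightarrow> norm y < R \<longrightarrow> \<bar>?V x - ?V y\<bar> \<le> L * norm (x - y)"
    if "R > 0" for R
  proof -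
    define L where "L = p * R powr (p - 1) + cost_lipschitz (norm J * R) * norm J"
    have "0 \<le> L" using p_ge_1 cost_lipschitz_nonneg by (simp add: L_def)
    have "\<bar>?V x - ?V y\<bar> \<le> (L + 1) * norm (x - y)" if xy: "norm x < R" "norm y < R" for x y
    proof -
      have "\<bar>norm x powr p - norm y powr p\<bar> \<le> p * R powr (p - 1) * \<bar>norm x - norm y\<bar>"
        using xy p_ge_1 by (intro powr_lipschitz) auto
      also have "\<dots> \<le> p * R powr (p - 1) * norm (x - y)"
        using p_ge_1 by (intro mult_left_mono norm_triangle_ineq3) auto
      finally have state: "\<bar>norm x powr p - norm y powr p\<bar> \<le> p * R powr (p - 1) * norm (x - y)" .
      have "norm (J z) \<le> norm J * R" if "norm z < R" for z
        using norm_J_le[of z] that by (meson less_imp_le mult_left_mono norm_ge_zero order_trans)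
      then have "\<bar>timer_sup 0 (J x) - timer_sup 0 (J y)\<bar>
          \<le> cost_lipschitz (norm J * R) * norm (J x - J y)"
        using xy by (intro timer_sup_lipschitz zero) auto
      also have "\<dots> \<le> cost_lipschitz (norm J * R) * (norm J * norm (x - y))"
        using norm_J_le[of "x - y"]
        by (intro mult_left_mono cost_lipschitz_nonneg) (simp add: blinfun.diff_right)
      finally have "\<bar>?V x - ?V y\<bar> \<le> L * norm (x - y)"
        using state unfolding L_def by (simp add: algebra_simps)
      then show ?thesis using norm_ge_zero[of "x - y"] unfolding distrib_right by linarith
    qed
    then show ?thesis using \<open>0 \<le> L\<close> by (intro exI[of _ "L + 1"]) auto
  qed
  moreover have "0 \<le> ?V x" for x using timer_sup_nonneg[OF zero] by simp
  moreover have "?V x \<le> (1 + cost_bound * norm J powr p) * norm x powr p" for x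
  proof -
    have "timer_sup 0 (J x) \<le> cost_bound * norm (J x) powr p" by (rule timer_sup_le[OF zero])
    also have "\<dots> \<le> cost_bound * (norm J * norm x) powr p"
      using norm_J_le[of x] p_pos cost_bound_pos by (intro mult_left_mono powr_mono2) auto
    finally show ?thesis by (simp add: powr_mult algebra_simps)
  qed
  moreover have "?V (S \<theta> (J x)) - ?V x \<le> - (norm x powr p)" if "\<theta> \<in> {Tmin..Tmax}" for \<theta> x
  proof -
    have "norm (S \<theta> (J x)) powr p \<le> stage p \<theta> (J x)"
      using that by (intro stage_ge_endpoint p_pos) auto
    then have "?V (S \<theta> (J x)) \<le> timer_sup 0 (J x)"
      using timer_sup_ge_first_stage[of 0 \<theta> "J x"] that Tmin_pos by simp
    then show ?thesis by simp
  qed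
  ultimately show ?thesis unfolding discrete_lyapunov_def by blast
qed

lemma trajectory_cost_le:
  assumes \<sigma>: "\<sigma> \<in> range_seqs Tmin Tmax" and "0 \<le> s"
  shows "trajectory_cost S J p \<sigma> s x \<le> ennreal (cost_bound * norm x powr p)"
proof -
  obtain u where u: "jump_grid \<sigma> s u" "gaps u 0 \<in> {0..Tmax}" "\<And>k. gaps u (Suc k) \<in> {Tmin..Tmax}"
    using jump_grid_exists[OF \<sigma> \<open>0 \<le> s\<close> Tmin_pos] by blast
  have d: "gaps u \<in> dwell 0 Tmax" using u by (simp add: dwell_def)
  have "\<sigma> \<in> impulse_seqs" using \<sigma> by (simp add: range_seqs_def)
  then have "trajectory_cost S J p \<sigma> s x = gap_cost p (gaps u) x"
    using trajectory_cost_on_grid[OF _ u(1) dwell_nth(2)[OF d] p_pos] by blast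
  then show ?thesis
    using total_cost_le[OF d] by (simp add: gap_cost_eq_total_cost[OF d] ennreal_leI)
qed

end

section \<open>The equivalences\<close>

text \<open>
  Before the first impulse the propagator of the slowest sequence, with all gaps equal to
  \<open>Tmax\<close>, is the semigroup itself. The growth condition thus bounds \<open>S t\<close> for \<open>t < Tmax\<close>, and
  \<open>t = Tmax\<close> is reached by composing two flows of half that length.
\<close>

lemma growth_condition_imp_semigroup_bound:
  fixes S :: "real \<Rightarrow> ('a::banach \<Rightarrow>\<^sub>L 'a)"
  assumes semigroup: "C0_semigroup S" and T: "0 < Tmin" "Tmin \<le> Tmax"
    and growth: "growth_condition S J Tmin Tmax"
  obtains C where "1 \<le> C" "\<And>t. 0 \<le> t \<Longrightarrow> t \<le> Tmax \<Longrightarrow> norm (S t) \<le> C"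
proof -
  obtain g \<mu> where est: "\<And>\<sigma> s t x. \<sigma> \<in> range_seqs Tmin Tmax \<Longrightarrow> 0 \<le> s \<Longrightarrow> s \<le> t \<Longrightarrow>
      norm (propagator S J \<sigma> t s x) \<le> g (t - s) * \<mu> ^ impulse_count \<sigma> t s * norm x"
    and bdd: "bdd_above (g ` {0..<Tmax})"
    using growth unfolding growth_condition_def by blast
  obtain G where G: "\<And>t. t \<in> {0..<Tmax} \<Longrightarrow> g t \<le> G"
    using bdd unfolding bdd_above_def by blast
  define C where "C = max 1 G"
  define \<sigma> where "\<sigma> k = (\<Sum>j<k. Tmax)" for k :: nat
  have \<sigma>: "\<sigma> \<in> range_seqs Tmin Tmax"
    unfolding \<sigma>_def using T by (intro range_seqs_partial_sums) auto
  then have grid: "jump_grid \<sigma> 0 \<sigma>" by (intro jump_grid_self) (simp add: range_seqs_def)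
  have below: "norm (S t) \<le> C" if t: "0 \<le> t" "t < Tmax" for t
  proof (rule norm_blinfun_bound)
    fix x
    have cell: "\<sigma> 0 \<le> t" "t < \<sigma> (Suc 0)" using t by (auto simp: \<sigma>_def)
    have "impulse_times \<sigma> \<inter> {0<..t} = {}" using jump_grid_window[OF grid cell] by simp
    then have "propagator S J \<sigma> t 0 = S t" by (simp add: propagator_def)
    moreover have "impulse_count \<sigma> t 0 = 0" by (rule jump_grid_count[OF grid cell])
    ultimately have "norm (S t x) \<le> g t * norm x" using est[OF \<sigma>, of 0 t x] t by simp
    also have "\<dots> \<le> C * norm x"
      using G[of t] t by (intro mult_right_mono) (auto simp: C_def)
    finally show "norm (S t x) \<le> C * norm x" .
  qed (simp add: C_def)
  have "norm (S Tmax) \<le> C * C"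
  proof -
    have half: "norm (S (Tmax / 2)) \<le> C" using T by (intro below) auto
    have "S Tmax = S (Tmax / 2) o\<^sub>L S (Tmax / 2)"
      using semigroup T unfolding C0_semigroup_def
      by (metis field_sum_of_halves half_gt_zero less_imp_le less_le_trans)
    then have "norm (S Tmax) \<le> norm (S (Tmax / 2)) * norm (S (Tmax / 2))"
      by (simp add: norm_blinfun_compose)
    also have "\<dots> \<le> C * C" using half by (intro mult_mono) (auto simp: C_def)
    finally show ?thesis .
  qed
  moreover have "C \<le> C * C" "1 \<le> C * C"
    using mult_mono[of 1 C 1 C] mult_right_mono[of 1 C C] by (auto simp: C_def)
  ultimately have "1 \<le> C * C" "norm (S t) \<le> C * C" if "0 \<le> t" "t \<le> Tmax" for t
    using below[of t] that by (cases "t = Tmax"; force)+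
  then show ?thesis using that[of "C * C"] \<open>1 \<le> C * C\<close> by blast
qed

theorem theorem4p10:
  fixes S :: "real \<Rightarrow> ('a::banach \<Rightarrow>\<^sub>L 'a)"
    and J :: "'a \<Rightarrow>\<^sub>L 'a"
    and A :: "'a \<Rightarrow> 'a"
    and D :: "'a set"
    and Tmin Tmax :: real
  assumes gen: "generates A D S"
    and J_nonzero: "J \<noteq> 0"
    and J_dom: "J ` D \<subseteq> D"
    and Tmin_pos: "0 < Tmin"
    and Tmin_le: "Tmin \<le> Tmax"
    and growth: "growth_condition S J Tmin Tmax"
  defines "cond_i \<equiv> strongly_UGES S J (range_seqs Tmin Tmax)"
    and "cond_ii \<equiv> (\<exists>p\<ge>1. \<exists>b>0. \<forall>\<sigma>\<in>range_seqs Tmin Tmax. \<forall>s\<ge>0. \<forall>x.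
           trajectory_cost S J p \<sigma> s x \<le> ennreal (b powr p * norm x powr p))"
    and "cond_iii \<equiv> (\<exists>p\<ge>1. \<exists>c>0. \<exists>V. timer_lyapunov S J Tmin Tmax p c V)"
    and "cond_iv \<equiv> (\<exists>p\<ge>1. \<exists>c>0. \<exists>V. discrete_lyapunov S J Tmin Tmax p c V)"
  shows "(cond_i \<longleftrightarrow> cond_ii) \<and> (cond_i \<longleftrightarrow> cond_iii) \<and> (cond_i \<longleftrightarrow> cond_iv) \<and>
    (cond_i \<longrightarrow> (\<forall>p\<ge>1.
       (\<forall>\<tau>\<in>{0..Tmax}. \<forall>x. sup_functional S J Tmin Tmax p \<tau> x < \<infinity>) \<and>
       (\<exists>c>0. timer_lyapunov S J Tmin Tmax p c
          (\<lambda>\<tau> x. enn2real (sup_functional S J Tmin Tmax p \<tau> x)))))"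
proof -
  have semigroup: "C0_semigroup S" using gen by (simp add: generates_def)
  obtain C where "1 \<le> C" "\<And>t. 0 \<le> t \<Longrightarrow> t \<le> Tmax \<Longrightarrow> norm (S t) \<le> C"
    using growth_condition_imp_semigroup_bound[OF semigroup Tmin_pos Tmin_le growth] by blast
  then interpret impulsive_flow S J C Tmin Tmax
    using semigroup Tmin_pos Tmin_le by unfold_locales
  have i: "cond_i \<longleftrightarrow> decaying"
    unfolding cond_i_def using strongly_UGES_imp_decaying decaying_imp_strongly_UGES by blast
  have "cond_ii \<Longrightarrow> decaying"
    unfolding cond_ii_def using integral_bound_imp_decaying by (metis order_refl)
  moreover have "cond_iii \<Longrightarrow> decaying"
    unfolding cond_iii_def using timer_lyapunov_imp_decaying by blast
  moreover have "cond_iv \<Longrightarrow> decaying"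
    unfolding cond_iv_def using discrete_lyapunov_imp_decaying by blast
  moreover have witness: "\<forall>p\<ge>1.
      (\<forall>\<tau>\<in>{0..Tmax}. \<forall>x. sup_functional S J Tmin Tmax p \<tau> x < \<infinity>) \<and>
      (\<exists>c>0. timer_lyapunov S J Tmin Tmax p c
        (\<lambda>\<tau> x. enn2real (sup_functional S J Tmin Tmax p \<tau> x)))"
    and "cond_ii" and "cond_iv" if decaying
  proof -
    obtain K r where Kr: "1 \<le> K" "0 < r" "r < 1"
      "\<And>d k. d \<in> dwell 0 Tmax \<Longrightarrow> norm (post_jump d k) \<le> K * r ^ k"
      using \<open>decaying\<close> unfolding decaying_def by blast
    show "\<forall>p\<ge>1. (\<forall>\<tau>\<in>{0..Tmax}. \<forall>x. sup_functional S J Tmin Tmax p \<tau> x < \<infinity>) \<and>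
      (\<exists>c>0. timer_lyapunov S J Tmin Tmax p c
        (\<lambda>\<tau> x. enn2real (sup_functional S J Tmin Tmax p \<tau> x)))"
    proof (intro allI impI)
      fix p :: real assume "1 \<le> p"
      with Kr interpret decaying_flow S J C Tmin Tmax K r p
        by unfold_locales
      show "(\<forall>\<tau>\<in>{0..Tmax}. \<forall>x. sup_functional S J Tmin Tmax p \<tau> x < \<infinity>) \<and>
        (\<exists>c>0. timer_lyapunov S J Tmin Tmax p c
          (\<lambda>\<tau> x. enn2real (sup_functional S J Tmin Tmax p \<tau> x)))"
        using sup_functional_eq_timer_sup cost_bound_pos timer_lyapunov_sup_functional
        by (auto simp: ennreal_less_top)
    qed
    interpret decaying_flow S J C Tmin Tmax K r 1
      using Kr by unfold_locales auto
    show cond_ii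
      unfolding cond_ii_def using trajectory_cost_le cost_bound_pos
      by (intro exI[of _ "1::real"] conjI exI[of _ cost_bound]) auto
    have "0 \<le> cost_bound * norm J powr 1" using cost_bound_pos by simp
    then have "0 < 1 + cost_bound * norm J powr 1" by linarith
    then show cond_iv
      unfolding cond_iv_def using discrete_lyapunov_timer_sup by blast
  qed
  moreover have "cond_iii" if decaying
    unfolding cond_iii_def using witness[OF that] by blast
  ultimately show ?thesis unfolding i by blast
qed

end
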